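(* For any $(a,b)\in\mathcal P$ with $b\ne a+1$, the finiteness condition holds for $f_{a,b}$. The set $\mathcal E\subset\mathcal P$ of exceptions to the finiteness condition, i.e. of those $(a,b)\in\mathcal P$ for which $f_{a,b}$ does not satisfy the finiteness condition, is an uncountable set of one-dimensional Lebesgue measure $0$ that lies on the boundary $b=a+1$ of $\mathcal P$.
   Context: $T(x)=x+1$ and $S(x)=-1/x$, acting on $\bar{\mathbb R}=\mathbb R\cup\{\infty\}$ and generating the modular group $SL(2,\mathbb Z)$ (acting by fractional linear transformations). $\mathcal P=\{(a,b)\in\mathbb R^2 : a\le 0\le b,\ b-a\ge 1,\ -ab\le 1\}$; the degenerate cases $a=0$, $b=0$, $(a,b)=(-1,1)$ are excluded from consideration. The map $f=f_{a,b}:\bar{\mathbb R}\to\bar{\mathbb R}$ is $f(x)=x+1$ if $x<a$, $f(x)=-1/x$ if $a\le x<b$, $f(x)=x-1$ if $x\ge b$. Orbits: the upper orbit of $a$ is $\{f^n(Sa)\}_{n\ge0}$, the lower orbit of $a$ is $\{f^n(Ta)\}_{n\ge0}$, the lower orbit of $b$ is $\{f^n(Sb)\}_{n\ge0}$ and the upper orbit of $b$ is $\{f^n(T^{-1}b)\}_{n\ge0}$. Convention: a lower orbit hitting $a$ (resp. $b$) continues with $Ta$ (resp. $Sb$); an upper orbit hitting $a$ (resp. $b$) continues with $Sa$ (resp. $T^{-1}b$). Cycles: $a$ has the cycle property if $f^{m_1}(Sa)=f^{k_1}(Ta)$ for some non-negative integers $m_1,k_1$ (the cycle being taken up to the first common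 value); its upper part is $\{Sa,\dots,f^{m_1-1}Sa\}$, its lower part $\{Ta,\dots,f^{k_1-1}Ta\}$; it is strong if $T^{-1}f^{-k_1}f^{m_1}S=\mathrm{Id}$ (powers of $f$ denoting the products of $T,S,T^{-1}$ applied along the orbit), weak otherwise. Likewise $b$ has the cycle property if $f^{k_2}(Sb)=f^{m_2}(T^{-1}b)$, with lower part $\{Sb,\dots,f^{k_2-1}Sb\}$ and upper part $\{T^{-1}b,\dots,f^{m_2-1}T^{-1}b\}$, strong if $Tf^{-m_2}f^{k_2}S=\mathrm{Id}$, weak otherwise. Truncated orbits: for $c\in\{a,b\}$, $\mathcal L_c$ (resp. $\mathcal U_c$) is the whole lower (resp. upper) orbit of $c$ if $c$ has no cycle property; the lower (resp. upper) part of the $c$-cycle if $c$ has the strong cycle property; the lower (resp. upper) part together with $0$ if $c$ has the weak cycle property. $f_{a,b}$ satisfies the finiteness condition if $\mathcal L_a,\mathcal L_b,\mathcal U_a,\mathcal U_b$ are all finite sets. *)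

theory Defs
  imports "HOL-Analysis.Analysis"
begin

section \<open>The extended real line and the generators of the modular group\<close>

datatype rbar = Fin real | Infty

fun T_map :: "rbar \<Rightarrow> rbar" where
  "T_map (Fin x) = Fin (x + 1)"
| "T_map Infty = Infty"

fun Tinv_map :: "rbar \<Rightarrow> rbar" where
  "Tinv_map (Fin x) = Fin (x - 1)"
| "Tinv_map Infty = Infty"

fun S_map :: "rbar \<Rightarrow> rbar" where
  "S_map (Fin x) = (if x = 0 then Infty else Fin (- 1 / x))"
| "S_map Infty = Fin 0"

section \<open>Parameters\<close>

definition param_set :: "(real \<times> real) set" where
  "param_set = {(a, b). a \<le> 0 \<and> 0 \<le> b \<and> b - a \<ge> 1 \<and> - a * b \<le> 1}"

definition nondegenerate :: "real \<Rightarrow> real \<Rightarrow> bool" where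
  "nondegenerate a b \<longleftrightarrow> a \<noteq> 0 \<and> b \<noteq> 0 \<and> (a, b) \<noteq> (- 1, 1)"

section \<open>The map \<open>f\<close> and the two kinds of orbits\<close>

text \<open>
  A branch function selects, for a point, which of the generators is applied there. The value
  at \<^term>\<open>Infty\<close> is a convention: \<open>T\<close> and its inverse both fix that point, and in the
  nondegenerate case an orbit reaches it only by way of \<^term>\<open>Fin 0\<close>, so that it is never
  passed before the first common value of two orbits.
\<close>

fun upper_branch :: "real \<Rightarrow> real \<Rightarrow> rbar \<Rightarrow> (rbar \<Rightarrow> rbar)" where
  "upper_branch a b (Fin x) = (if x < a then T_map else if x < b then S_map else Tinv_map)"
| "upper_branch a b Infty = Tinv_map"

text \<open>
  Lower orbits differ only at the discontinuities: \<open>a\<close> is followed by \<open>T a\<close>, and \<open>b\<close> by \<open>S b\<close>.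
\<close>

fun lower_branch :: "real \<Rightarrow> real \<Rightarrow> rbar \<Rightarrow> (rbar \<Rightarrow> rbar)" where
  "lower_branch a b (Fin x) = (if x \<le> a then T_map else if x \<le> b then S_map else Tinv_map)"
| "lower_branch a b Infty = Tinv_map"

text \<open>
  The map \<open>f\<^bsub>a,b\<^esub>\<close> itself. Since \<open>f a = S a\<close> and \<open>f b = T\<^sup>-\<^sup>1 b\<close>, iterating it
  already follows the convention for upper orbits.
\<close>

definition ab_map :: "real \<Rightarrow> real \<Rightarrow> rbar \<Rightarrow> rbar" where
  "ab_map a b x = upper_branch a b x x"

definition ab_map_lower :: "real \<Rightarrow> real \<Rightarrow> rbar \<Rightarrow> rbar" where
  "ab_map_lower a b x = lower_branch a b x x"

definition upper_orbit_a :: "real \<Rightarrow> real \<Rightarrow> nat \<Rightarrow> rbar" where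
  "upper_orbit_a a b n = (ab_map a b ^^ n) (S_map (Fin a))"

definition lower_orbit_a :: "real \<Rightarrow> real \<Rightarrow> nat \<Rightarrow> rbar" where
  "lower_orbit_a a b n = (ab_map_lower a b ^^ n) (T_map (Fin a))"

definition upper_orbit_b :: "real \<Rightarrow> real \<Rightarrow> nat \<Rightarrow> rbar" where
  "upper_orbit_b a b n = (ab_map a b ^^ n) (Tinv_map (Fin b))"

definition lower_orbit_b :: "real \<Rightarrow> real \<Rightarrow> nat \<Rightarrow> rbar" where
  "lower_orbit_b a b n = (ab_map_lower a b ^^ n) (S_map (Fin b))"

text \<open>
  The \<open>n\<close>-th power of \<open>f\<close> along an orbit \<open>s\<close>, as a fractional linear transformation: the
  composition of the generators applied at the points \<open>s 0, \<dots>, s (n - 1)\<close>.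
\<close>

primrec orbit_product :: "(rbar \<Rightarrow> (rbar \<Rightarrow> rbar)) \<Rightarrow> (nat \<Rightarrow> rbar) \<Rightarrow> nat \<Rightarrow> (rbar \<Rightarrow> rbar)" where
  "orbit_product br s 0 = id"
| "orbit_product br s (Suc n) = br (s n) \<circ> orbit_product br s n"

section \<open>Cycles\<close>

text \<open>Throughout, \<open>u\<close> is the upper and \<open>l\<close> the lower orbit of one of the two discontinuities.\<close>

definition cycle_property :: "(nat \<Rightarrow> rbar) \<Rightarrow> (nat \<Rightarrow> rbar) \<Rightarrow> bool" where
  "cycle_property u l \<longleftrightarrow> (\<exists>m k. u m = l k)"

text \<open>
  The end of the cycle is the first point of the upper orbit lying on the lower orbit. The two
  indices are then minimal: no earlier point of one orbit coincides with the end or with an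
  earlier point of the other.
\<close>

definition upper_length :: "(nat \<Rightarrow> rbar) \<Rightarrow> (nat \<Rightarrow> rbar) \<Rightarrow> nat" where
  "upper_length u l = (LEAST m. \<exists>k. u m = l k)"

definition lower_length :: "(nat \<Rightarrow> rbar) \<Rightarrow> (nat \<Rightarrow> rbar) \<Rightarrow> nat" where
  "lower_length u l = (LEAST k. u (upper_length u l) = l k)"

definition strong_cycle_a :: "real \<Rightarrow> real \<Rightarrow> bool" where
  "strong_cycle_a a b \<longleftrightarrow>
     (let u = upper_orbit_a a b; l = lower_orbit_a a b;
          m = upper_length u l; k = lower_length u l
      in cycle_property u l \<and>
         Tinv_map \<circ> inv (orbit_product (lower_branch a b) l k)
           \<circ> orbit_product (upper_branch a b) u m \<circ> S_map = id)"

definition strong_cycle_b :: "real \<Rightarrow> real \<Rightarrow> bool" where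
  "strong_cycle_b a b \<longleftrightarrow>
     (let u = upper_orbit_b a b; l = lower_orbit_b a b;
          m = upper_length u l; k = lower_length u l
      in cycle_property u l \<and>
         T_map \<circ> inv (orbit_product (upper_branch a b) u m)
           \<circ> orbit_product (lower_branch a b) l k \<circ> S_map = id)"

section \<open>Truncated orbits and the finiteness condition\<close>

definition truncated_orbit :: "bool \<Rightarrow> bool \<Rightarrow> (nat \<Rightarrow> rbar) \<Rightarrow> nat \<Rightarrow> rbar set" where
  "truncated_orbit cyclic strong s n =
     (if \<not> cyclic then range s
      else if strong then s ` {..<n}
      else s ` {..<n} \<union> {Fin 0})"

definition trunc_upper_a :: "real \<Rightarrow> real \<Rightarrow> rbar set" where
  "trunc_upper_a a b =
     (let u = upper_orbit_a a b; l = lower_orbit_a a b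
      in truncated_orbit (cycle_property u l) (strong_cycle_a a b) u (upper_length u l))"

definition trunc_lower_a :: "real \<Rightarrow> real \<Rightarrow> rbar set" where
  "trunc_lower_a a b =
     (let u = upper_orbit_a a b; l = lower_orbit_a a b
      in truncated_orbit (cycle_property u l) (strong_cycle_a a b) l (lower_length u l))"

definition trunc_upper_b :: "real \<Rightarrow> real \<Rightarrow> rbar set" where
  "trunc_upper_b a b =
     (let u = upper_orbit_b a b; l = lower_orbit_b a b
      in truncated_orbit (cycle_property u l) (strong_cycle_b a b) u (upper_length u l))"

definition trunc_lower_b :: "real \<Rightarrow> real \<Rightarrow> rbar set" where
  "trunc_lower_b a b =
     (let u = upper_orbit_b a b; l = lower_orbit_b a b
      in truncated_orbit (cycle_property u l) (strong_cycle_b a b) l (lower_length u l))"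

definition finiteness_condition :: "real \<Rightarrow> real \<Rightarrow> bool" where
  "finiteness_condition a b \<longleftrightarrow>
     finite (trunc_lower_a a b) \<and> finite (trunc_lower_b a b) \<and>
     finite (trunc_upper_a a b) \<and> finite (trunc_upper_b a b)"

definition exceptions :: "(real \<times> real) set" where
  "exceptions = {(a, b) \<in> param_set. nondegenerate a b \<and> \<not> finiteness_condition a b}"

section \<open>Null sets on the line \<open>b = a + 1\<close>\<close>

text \<open>
  The parametrization \<open>t \<mapsto> (t, t + 1)\<close> of the line has constant speed, so a subset of
  the line has one-dimensional measure zero iff its preimage is a Lebesgue null set.
\<close>

definition null_on_boundary_line :: "(real \<times> real) set \<Rightarrow> bool" where
  "null_on_boundary_line X \<longleftrightarrow> {t. (t, t + 1) \<in> X} \<in> null_sets (lebesgue :: real measure)"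

end

theory Submission
  imports Defs
begin

text \<open>
  The proof follows the upper and the lower orbit of \<open>a\<close> simultaneously. For \<open>- 1 < a\<close> they start at
  \<open>x = - 1 / a\<close> and \<open>1 - 1 / x\<close>, and as long as nothing exceptional happens they return, after a few
  steps each, to a pair \<open>(x', 1 - 1 / x')\<close>, where \<open>x'\<close> is \<open>x - 1\<close> or \<open>x / (1 - x)\<close>: one step of the
  subtractive Euclidean algorithm (\<open>euclid_step\<close>). The branches apply on the two sides of an open
  hole \<open>(1 / (1 - a), 1 + b)\<close> around \<open>1\<close>, and as soon as \<open>x\<close> falls into the hole, the two orbits
  merge (\<open>hole_merge\<close>). So \<open>a\<close> has the cycle property unless the Euclidean orbit of \<open>- 1 / a\<close> is
  trapped outside the hole, within \<open>[b, - 1 / a]\<close>. Reflection in \<open>0\<close> transfers this to \<open>b\<close>. A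
  trapped orbit behaves like an orbit of a rotation of the circle, and the three assertions are
  about such orbits.

  Off the line \<open>b = a + 1\<close>, the images of the two branches are separated by a gap. As the branches
  expand, a gap cannot shrink along the orbit, and an orbit with infinitely many points
  in a bounded interval has no room for this (\<open>not_inj_if_gap\<close>). So trapped orbits are
  eventually periodic, and both orbits of \<open>a\<close> are finite.

  On the line, a trapped starting point belongs to a set that is bounded, bounded away from
  \<open>0\<close>, and mapped to itself by the Euclidean step; such points have bounded partial quotients. That they
  form a null set follows from the invariance of the measure \<open>dx / x\<close>
  (\<open>euclid_invariant_negligible\<close>).

  Finally, every irrational rotation angle \<open>\<alpha>\<close> in \<open>(1 / 2, 1)\<close> occurs. Applying inverse
  branches along the Sturmian word of slope \<open>\<alpha>\<close> defines a monotone function \<open>sturmian \<alpha>\<close> on the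
  circle that carries the rotation to the Euclidean step, and its one-sided values at \<open>0\<close>
  give the parameters \<open>b\<close> and \<open>- 1 / a\<close>. The resulting orbit is trapped and has no periods, and the
  lower and upper orbit of \<open>a\<close> stay in disjoint sets (\<open>not_settled_if_inj\<close>). The itinerary determines
  \<open>\<alpha>\<close>, so there are uncountably many exceptions.
\<close>

section \<open>Reduction to the discontinuity \<open>a\<close>\<close>

text \<open>
  The share of \<open>a\<close> in the finiteness condition: a truncated orbit is finite as soon as its
  cycle closes, so only an infinite orbit without a cycle can violate the condition.
\<close>

definition settled :: "real \<Rightarrow> real \<Rightarrow> bool" where
  "settled a b \<longleftrightarrow> cycle_property (upper_orbit_a a b) (lower_orbit_a a b) \<or>
     finite (range (upper_orbit_a a b)) \<and> finite (range (lower_orbit_a a b))"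

text \<open>
  Reflection in \<open>0\<close> exchanges \<open>T\<close> with its inverse and commutes with \<open>S\<close>, so it conjugates
  the map with parameters \<open>(a, b)\<close> to the one with parameters \<open>(- b, - a)\<close>. It reverses the
  order, hence also the side on which each discontinuity is continued, and so it swaps upper and
  lower orbits. This reduces all questions about \<open>b\<close> to questions about \<open>a\<close>.
\<close>

fun neg_map :: "rbar \<Rightarrow> rbar" where
  "neg_map (Fin x) = Fin (- x)"
| "neg_map Infty = Infty"

lemma neg_map_inj: "neg_map x = neg_map y \<longleftrightarrow> x = y"
  by (cases x; cases y) auto

lemma ab_map_neg:
  assumes "a \<le> b"
  shows "ab_map a b (neg_map z) = neg_map (ab_map_lower (- b) (- a) z)"
  using assms by (cases z) (auto simp: ab_map_def ab_map_lower_def)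

lemma ab_map_lower_neg:
  assumes "a \<le> b"
  shows "ab_map_lower a b (neg_map z) = neg_map (ab_map (- b) (- a) z)"
  using assms by (cases z) (auto simp: ab_map_def ab_map_lower_def)

lemma upper_orbit_b_neg:
  assumes "a \<le> b"
  shows "upper_orbit_b a b n = neg_map (lower_orbit_a (- b) (- a) n)"
  unfolding upper_orbit_b_def lower_orbit_a_def
  by (induction n) (auto simp flip: ab_map_neg[OF assms])

lemma lower_orbit_b_neg:
  assumes "a \<le> b"
  shows "lower_orbit_b a b n = neg_map (upper_orbit_a (- b) (- a) n)"
  unfolding lower_orbit_b_def upper_orbit_a_def
  by (induction n) (auto simp flip: ab_map_lower_neg[OF assms])

lemma finite_truncated_orbit:
  "finite (truncated_orbit cyclic strong s n) \<longleftrightarrow> cyclic \<or> finite (range s)"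
  by (simp add: truncated_orbit_def)

lemma finite_range_neg: "finite (range (\<lambda>n. neg_map (s n))) \<longleftrightarrow> finite (range s)"
proof -
  have "range (\<lambda>n. neg_map (s n)) = neg_map ` range s"
    by auto
  then show ?thesis
    using finite_image_iff[of neg_map "range s"] by (simp add: inj_on_def neg_map_inj)
qed

lemma finiteness_condition_iff_settled:
  assumes "a \<le> b"
  shows "finiteness_condition a b \<longleftrightarrow> settled a b \<and> settled (- b) (- a)"
proof -
  have up: "upper_orbit_b a b = (\<lambda>n. neg_map (lower_orbit_a (- b) (- a) n))"
    and lo: "lower_orbit_b a b = (\<lambda>n. neg_map (upper_orbit_a (- b) (- a) n))"
    using assms by (auto simp: upper_orbit_b_neg lower_orbit_b_neg)
  have cyc: "cycle_property (upper_orbit_b a b) (lower_orbit_b a b) \<longleftrightarrow>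
      cycle_property (upper_orbit_a (- b) (- a)) (lower_orbit_a (- b) (- a))"
    unfolding up lo cycle_property_def by (metis neg_map_inj)
  show ?thesis
    unfolding finiteness_condition_def trunc_upper_a_def trunc_lower_a_def trunc_upper_b_def
      trunc_lower_b_def Let_def finite_truncated_orbit settled_def cyc
    unfolding up lo finite_range_neg by blast
qed

section \<open>The two orbits of \<open>a\<close> follow the subtractive Euclidean algorithm\<close>

text \<open>
  For a ratio \<open>x = p / q\<close> this subtracts the smaller of \<open>p\<close> and \<open>q\<close> from the larger. The value at
  \<open>1\<close> is \<open>0\<close>, which leaves every set of positive numbers on which the map is iterated below.
\<close>

definition euclid_step :: "real \<Rightarrow> real" where
  "euclid_step x = (if x < 1 then x / (1 - x) else x - 1)"

text \<open>
  The parameters with \<open>- 1 < a\<close>; for \<open>a \<le> - 1\<close> the cycle of \<open>a\<close> closes after at most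
  three steps (\<open>settled_if_le_minus_1\<close>).
\<close>

locale interior_params =
  fixes a b :: real
  assumes a_gt: "- 1 < a" and a_neg: "a < 0" and b_pos: "0 < b"
    and width: "a + 1 \<le> b" and hyperbola: "- a * b \<le> 1"
begin

abbreviation "apex \<equiv> - 1 / a"

text \<open>
  On \<open>[b, - 1 / a]\<close> the points below the hole are those with \<open>x / (1 - x) \<le> - 1 / a\<close>, and the
  points above it those with \<open>b \<le> x - 1\<close>. Outside the hole, the Euclidean step therefore maps the
  interval to itself. The hole is open because a lower orbit at \<open>a\<close> continues with \<open>T a\<close> and an upper
  orbit at \<open>b\<close> with \<open>T\<^sup>-\<^sup>1 b\<close>.
\<close>

definition hole :: "real set" where
  "hole = {1 / (1 - a)<..<1 + b}"

lemma not_hole_cases: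
  assumes "x \<notin> hole"
  obtains (low) "x \<le> 1 / (1 - a)" "x < 1" | (high) "1 + b \<le> x" "1 < x"
proof -
  have "1 / (1 - a) < 1"
    using a_neg by (simp add: divide_simps)
  then show ?thesis
    using assms b_pos low high unfolding hole_def by fastforce
qed

lemma apex_gt_1: "1 < apex" and b_le_apex: "b \<le> apex"
  using a_gt a_neg hyperbola by (auto simp: field_simps)

text \<open>
  The upper orbit of \<open>a\<close> starts at \<open>x = - 1 / a\<close> and the lower one at \<open>a + 1 = 1 - 1 / x\<close>. The
  next three lemmas follow a pair \<open>(x, 1 - 1 / x)\<close> until it has this form again or its points meet. For large \<open>x\<close> the
  upper point moves by \<open>T\<^sup>-\<^sup>1\<close> and the lower one by \<open>T T S\<close>, which sends \<open>1 - 1 / x\<close>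
  to \<open>1 - 1 / (x - 1)\<close>.
\<close>

lemma high_step:
  assumes "1 + b \<le> x" "x \<le> apex"
  shows "euclid_step x \<in> {b..apex}" "ab_map a b (Fin x) = Fin (euclid_step x)"
    "ab_map_lower a b (Fin (1 - 1 / x)) = Fin (- x / (x - 1))"
    "ab_map_lower a b (Fin (- x / (x - 1))) = Fin (- 1 / (x - 1))"
    "ab_map_lower a b (Fin (- 1 / (x - 1))) = Fin (1 - 1 / euclid_step x)"
proof -
  have x: "1 < x"
    using assms b_pos by simp
  show step: "euclid_step x \<in> {b..apex}" "ab_map a b (Fin x) = Fin (euclid_step x)"
    using assms x a_neg b_pos by (auto simp: euclid_step_def ab_map_def)
  have "1 - 1 / x \<le> 1 + a"
    using assms x a_neg by (simp add: field_simps)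
  moreover have "0 < 1 - 1 / x"
    using x by simp
  moreover have "- 1 / (1 - 1 / x) = - x / (x - 1)"
    using x by (simp add: field_simps)
  ultimately have "\<not> 1 - 1 / x \<le> a" "1 - 1 / x \<le> b" "1 - 1 / x \<noteq> 0"
    "- 1 / (1 - 1 / x) = - x / (x - 1)"
    using a_neg width by linarith+
  then show "ab_map_lower a b (Fin (1 - 1 / x)) = Fin (- x / (x - 1))"
    by (simp only: ab_map_lower_def lower_branch.simps S_map.simps if_True if_False)
  have le: "- 1 / (x - 1) \<le> a"
    using step(1) x a_neg by (auto simp: euclid_step_def field_simps)
  have eq: "- x / (x - 1) = - 1 / (x - 1) - 1"
    using x by (simp add: field_simps)
  show "ab_map_lower a b (Fin (- x / (x - 1))) = Fin (- 1 / (x - 1))"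
    using le unfolding eq by (simp add: ab_map_lower_def)
  show "ab_map_lower a b (Fin (- 1 / (x - 1))) = Fin (1 - 1 / euclid_step x)"
    using le x by (simp add: ab_map_lower_def euclid_step_def)
qed

text \<open>
  Here the roles are exchanged: the lower point moves by \<open>T\<close> alone, the upper one by
  \<open>T\<^sup>-\<^sup>1 S T\<^sup>-\<^sup>1\<close>, that is, \<open>x\<close> goes to \<open>1 / (1 - x) - 1 = x / (1 - x)\<close>.
\<close>

lemma low_step:
  assumes "b \<le> x" "x \<le> 1 / (1 - a)"
  shows "euclid_step x \<in> {b..apex}"
    "ab_map a b (Fin x) = Fin (x - 1)"
    "ab_map a b (Fin (x - 1)) = Fin (1 / (1 - x))"
    "ab_map a b (Fin (1 / (1 - x))) = Fin (euclid_step x)"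
    "1 - 1 / x \<le> a"
    "ab_map_lower a b (Fin (1 - 1 / x)) = Fin (1 - 1 / euclid_step x)"
proof -
  have x1: "x * (1 - a) \<le> 1"
    using assms a_neg by (simp add: field_simps)
  have "1 / (1 - a) < 1"
    using a_neg by (simp add: divide_simps)
  then have x: "0 < x" "x < 1"
    using assms b_pos by auto
  have "b * (1 - x) \<le> b * 1"
    using x b_pos by (intro mult_left_mono) auto
  then have "b \<le> x / (1 - x)"
    using x assms by (simp add: field_simps)
  moreover have "x / (1 - x) \<le> apex"
    using x x1 a_neg by (simp add: field_simps)
  ultimately show "euclid_step x \<in> {b..apex}"
    using x by (simp add: euclid_step_def)
  show "ab_map a b (Fin x) = Fin (x - 1)"
    using assms a_neg b_pos by (simp add: ab_map_def)
  show "ab_map a b (Fin (x - 1)) = Fin (1 / (1 - x))"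
    using assms x width b_pos by (auto simp: ab_map_def field_simps)
  have "1 \<le> 1 / (1 - x)"
    using x by simp
  moreover have "b < 1"
    using assms x by simp
  ultimately have "\<not> 1 / (1 - x) < b" "\<not> 1 / (1 - x) < a"
    using a_neg by linarith+
  then show "ab_map a b (Fin (1 / (1 - x))) = Fin (euclid_step x)"
    using x by (simp add: ab_map_def euclid_step_def field_simps)
  show le: "1 - 1 / x \<le> a"
    using x x1 by (simp add: field_simps)
  then show "ab_map_lower a b (Fin (1 - 1 / x)) = Fin (1 - 1 / euclid_step x)"
    using x by (simp add: ab_map_lower_def euclid_step_def field_simps)
qed

text \<open>
  After one step the points are \<open>z = x - 1\<close> and \<open>- 1 - 1 / z\<close>, and in the hole the former is moved
  by \<open>S\<close>. So \<open>- 1 / z\<close> and \<open>- 1 / z - 1\<close> remain, and \<open>T\<close> or \<open>T\<^sup>-\<^sup>1\<close> makes them meet,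
  according to the sign of \<open>z\<close>. At \<open>z = 0\<close> they have met already.
\<close>

lemma hole_merge:
  assumes "x \<in> hole" "x \<in> {b..apex}"
  shows "\<exists>i j. (ab_map a b ^^ i) (Fin x) = (ab_map_lower a b ^^ j) (Fin (1 - 1 / x))"
proof -
  have x: "1 / (1 - a) < x" "x < 1 + b" "b \<le> x" "x \<le> apex" "0 < x"
    using assms b_pos by (auto simp: hole_def)
  have ax: "1 < x * (1 - a)"
    using x a_neg by (simp add: field_simps)
  have "a * a > 0"
    using a_neg by (simp add: mult_neg_neg)
  then have "1 + a < 1 / (1 - a)"
    using a_neg by (simp add: field_simps)
  then have x1: "a < x - 1"
    using x by simp
  have u1: "ab_map a b (Fin x) = Fin (x - 1)"
    using x a_neg by (simp add: ab_map_def)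
  consider "x = 1" | "x \<noteq> 1"
    by blast
  then show ?thesis
  proof cases
    case 1
    then have "(ab_map a b ^^ 1) (Fin x) = (ab_map_lower a b ^^ 0) (Fin (1 - 1 / x))"
      using u1 by simp
    then show ?thesis by blast
  next
    case 2
    have "a < 1 - 1 / x"
      using ax x by (simp add: field_simps)
    moreover have "1 - 1 / x \<le> 1 + a"
      using x a_neg by (simp add: field_simps)
    moreover have "1 - 1 / x \<noteq> 0" "- 1 / (1 - 1 / x) = - 1 - 1 / (x - 1)"
      using 2 x by (auto simp: field_simps)
    ultimately have l1: "ab_map_lower a b (Fin (1 - 1 / x)) = Fin (- 1 - 1 / (x - 1))"
      using width by (simp add: ab_map_lower_def)
    have u2: "ab_map a b (Fin (x - 1)) = Fin (- 1 / (x - 1))"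
      using x x1 2 by (simp add: ab_map_def)
    show ?thesis
    proof (cases "x < 1")
      case True
      then have "1 \<le> - 1 / (x - 1)"
        using x by (simp add: field_simps)
      moreover have "b < 1"
        using x True by simp
      ultimately have "\<not> - 1 / (x - 1) < b" "\<not> - 1 / (x - 1) < a"
        using a_neg by linarith+
      then have "ab_map a b (Fin (- 1 / (x - 1))) = Fin (- 1 - 1 / (x - 1))"
        by (simp add: ab_map_def)
      then have "(ab_map a b ^^ 3) (Fin x) = (ab_map_lower a b ^^ 1) (Fin (1 - 1 / x))"
        using u1 u2 l1 by (simp add: eval_nat_numeral)
      then show ?thesis by blast
    next
      case False
      then have "0 < 1 / (x - 1)"
        using 2 by simp
      then have "- 1 - 1 / (x - 1) \<le> a"
        using a_gt by linarith
      then have "ab_map_lower a b (Fin (- 1 - 1 / (x - 1))) = Fin (- 1 / (x - 1))"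
        by (simp add: ab_map_lower_def)
      then have "(ab_map a b ^^ 2) (Fin x) = (ab_map_lower a b ^^ 2) (Fin (1 - 1 / x))"
        using u1 u2 l1 by (simp add: eval_nat_numeral)
      then show ?thesis by blast
    qed
  qed
qed

lemma one_step:
  assumes "x \<in> {b..apex}" "x \<notin> hole"
  shows "euclid_step x \<in> {b..apex}"
    "\<exists>i\<ge>1. (ab_map a b ^^ i) (Fin x) = Fin (euclid_step x)"
    "\<exists>j\<ge>1. (ab_map_lower a b ^^ j) (Fin (1 - 1 / x)) = Fin (1 - 1 / euclid_step x)"
proof -
  have "euclid_step x \<in> {b..apex} \<and>
    (\<exists>i\<ge>1. (ab_map a b ^^ i) (Fin x) = Fin (euclid_step x)) \<and>
    (\<exists>j\<ge>1. (ab_map_lower a b ^^ j) (Fin (1 - 1 / x)) = Fin (1 - 1 / euclid_step x))"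
    using assms(2)
  proof (cases rule: not_hole_cases)
    case low
    then have b: "b \<le> x"
      using assms by simp
    note s = low_step[OF b low(1)]
    have "(ab_map a b ^^ 3) (Fin x) = Fin (euclid_step x)"
      using s by (simp add: eval_nat_numeral)
    moreover have "(ab_map_lower a b ^^ 1) (Fin (1 - 1 / x)) = Fin (1 - 1 / euclid_step x)"
      using s by simp
    ultimately show ?thesis
      using s(1) by (meson order_refl one_le_numeral)
  next
    case high
    then have t: "x \<le> apex"
      using assms by simp
    note s = high_step[OF high(1) t]
    have "(ab_map_lower a b ^^ 3) (Fin (1 - 1 / x)) = Fin (1 - 1 / euclid_step x)"
      using s by (simp add: eval_nat_numeral)
    moreover have "(ab_map a b ^^ 1) (Fin x) = Fin (euclid_step x)"
      using s by simp
    ultimately show ?thesis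
      using s(1) by (meson order_refl one_le_numeral)
  qed
  then show "euclid_step x \<in> {b..apex}"
    "\<exists>i\<ge>1. (ab_map a b ^^ i) (Fin x) = Fin (euclid_step x)"
    "\<exists>j\<ge>1. (ab_map_lower a b ^^ j) (Fin (1 - 1 / x)) = Fin (1 - 1 / euclid_step x)"
    by blast+
qed

text \<open>
  The bounds \<open>i \<ge> n\<close> and \<open>j \<ge> n\<close> make sure that a return of the Euclidean orbit to an earlier
  point takes a positive number of steps on both sides.
\<close>

lemma track:
  assumes "x \<in> {b..apex}" "\<And>k. k < n \<Longrightarrow> (euclid_step ^^ k) x \<notin> hole"
  shows "(euclid_step ^^ n) x \<in> {b..apex} \<and>
    (\<exists>i\<ge>n. (ab_map a b ^^ i) (Fin x) = Fin ((euclid_step ^^ n) x)) \<and>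
    (\<exists>j\<ge>n. (ab_map_lower a b ^^ j) (Fin (1 - 1 / x)) = Fin (1 - 1 / (euclid_step ^^ n) x))"
  using assms
proof (induction n)
  case 0
  then show ?case
    by (auto intro!: exI[of _ 0])
next
  case (Suc n)
  define z where "z = (euclid_step ^^ n) x"
  from Suc obtain i j where ij: "i \<ge> n" "(ab_map a b ^^ i) (Fin x) = Fin z"
      "j \<ge> n" "(ab_map_lower a b ^^ j) (Fin (1 - 1 / x)) = Fin (1 - 1 / z)"
    and z: "z \<in> {b..apex}" "z \<notin> hole"
    by (auto simp: z_def)
  from one_step[OF z] obtain i' j' where ij': "i' \<ge> 1" "(ab_map a b ^^ i') (Fin z) = Fin (euclid_step z)"
      "j' \<ge> 1" "(ab_map_lower a b ^^ j') (Fin (1 - 1 / z)) = Fin (1 - 1 / euclid_step z)"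
    by blast
  have "(ab_map a b ^^ (i' + i)) (Fin x) = Fin (euclid_step z)" "i' + i \<ge> Suc n"
       "(ab_map_lower a b ^^ (j' + j)) (Fin (1 - 1 / x)) = Fin (1 - 1 / euclid_step z)" "j' + j \<ge> Suc n"
    using ij ij' by (auto simp: funpow_add)
  then show ?case
    using one_step(1)[OF z] unfolding z_def funpow.simps comp_apply by blast
qed

lemma upper_orbit_a_apex: "upper_orbit_a a b n = (ab_map a b ^^ n) (Fin apex)"
  and lower_orbit_a_apex: "lower_orbit_a a b n = (ab_map_lower a b ^^ n) (Fin (1 - 1 / apex))"
  using a_neg by (auto simp: upper_orbit_a_def lower_orbit_a_def add.commute)

definition trapped :: bool where
  "trapped \<longleftrightarrow> (\<forall>n. (euclid_step ^^ n) apex \<notin> hole)"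

lemma trapped_range:
  assumes trapped
  shows "(euclid_step ^^ n) apex \<in> {b..apex}"
  using track[of apex n] assms b_le_apex by (simp add: trapped_def)

lemma cycle_if_not_trapped:
  assumes "\<not> trapped"
  shows "cycle_property (upper_orbit_a a b) (lower_orbit_a a b)"
proof -
  define n where "n = (LEAST n. (euclid_step ^^ n) apex \<in> hole)"
  define z where "z = (euclid_step ^^ n) apex"
  have "\<exists>n. (euclid_step ^^ n) apex \<in> hole"
    using assms by (simp add: trapped_def)
  then have n: "z \<in> hole" "\<And>k. k < n \<Longrightarrow> (euclid_step ^^ k) apex \<notin> hole"
    unfolding n_def z_def by (auto dest: not_less_Least intro: LeastI_ex)
  have "apex \<in> {b..apex}"
    using b_le_apex by simp
  from track[OF this, of n] n(2) obtain i j where z: "z \<in> {b..apex}"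
      and ij: "(ab_map a b ^^ i) (Fin apex) = Fin z"
      "(ab_map_lower a b ^^ j) (Fin (1 - 1 / apex)) = Fin (1 - 1 / z)"
    unfolding z_def by blast
  from hole_merge[OF n(1) z] obtain i' j' where
    "(ab_map a b ^^ i') (Fin z) = (ab_map_lower a b ^^ j') (Fin (1 - 1 / z))"
    by blast
  then have "upper_orbit_a a b (i' + i) = lower_orbit_a a b (j' + j)"
    using ij by (simp add: upper_orbit_a_apex lower_orbit_a_apex funpow_add)
  then show ?thesis
    unfolding cycle_property_def by blast
qed

end

text \<open>
  An orbit that meets itself is eventually periodic.
\<close>

lemma finite_range_funpow:
  fixes f :: "'a \<Rightarrow> 'a"
  assumes "(f ^^ p) x = (f ^^ q) x" "p < q"
  shows "finite (range (\<lambda>n. (f ^^ n) x))"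
proof -
  have "(f ^^ n) x \<in> (\<lambda>n. (f ^^ n) x) ` {..<q}" for n
  proof (induction n rule: less_induct)
    case (less n)
    show ?case
    proof (cases "n < q")
      case False
      then have "(f ^^ n) x = (f ^^ (n - q)) ((f ^^ q) x)"
        by (metis comp_apply funpow_add le_add_diff_inverse2 not_less)
      also have "\<dots> = (f ^^ (n - q + p)) x"
        by (simp add: assms(1) funpow_add)
      finally show ?thesis
        using less[of "n - q + p"] False assms(2) by simp
    qed simp
  qed
  then have "range (\<lambda>n. (f ^^ n) x) \<subseteq> (\<lambda>n. (f ^^ n) x) ` {..<q}"
    by blast
  then show ?thesis
    using finite_subset by blast
qed

context interior_params
begin

lemma settled_if_periodic:
  assumes trapped "(euclid_step ^^ p) apex = (euclid_step ^^ q) apex" "p < q"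
  shows "settled a b"
proof -
  define z where "z = (euclid_step ^^ p) apex"
  have z: "z \<in> {b..apex}"
    using trapped_range[OF assms(1)] by (simp add: z_def)
  have zq: "(euclid_step ^^ (q - p)) z = z"
    using assms unfolding z_def
    by (metis comp_apply funpow_add le_add_diff_inverse2 less_imp_le)
  have nh: "(euclid_step ^^ k) z \<notin> hole" for k
    using assms(1) unfolding z_def trapped_def by (metis comp_apply funpow_add)
  have "apex \<in> {b..apex}"
    using b_le_apex by simp
  from track[OF this, of p] assms(1) obtain i j where
      ij: "(ab_map a b ^^ i) (Fin apex) = Fin z"
      "(ab_map_lower a b ^^ j) (Fin (1 - 1 / apex)) = Fin (1 - 1 / z)"
    unfolding z_def trapped_def by blast
  from track[OF z, of "q - p"] nh zq obtain i' j' where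
      ij': "i' \<ge> q - p" "(ab_map a b ^^ i') (Fin z) = Fin z"
      "j' \<ge> q - p" "(ab_map_lower a b ^^ j') (Fin (1 - 1 / z)) = Fin (1 - 1 / z)"
    by auto
  have "finite (range (\<lambda>n. (ab_map a b ^^ n) (Fin apex)))"
    by (rule finite_range_funpow[where p = i and q = "i' + i"])
      (use ij ij' assms(3) in \<open>simp_all add: funpow_add\<close>)
  moreover have "finite (range (\<lambda>n. (ab_map_lower a b ^^ n) (Fin (1 - 1 / apex))))"
    by (rule finite_range_funpow[where p = j and q = "j' + j"])
      (use ij ij' assms(3) in \<open>simp_all add: funpow_add\<close>)
  ultimately show ?thesis
    unfolding settled_def upper_orbit_a_apex[abs_def] lower_orbit_a_apex[abs_def] by blast
qed

end

section \<open>Trapped orbits are finite off the line \<open>b = a + 1\<close>\<close>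

text \<open>
  By compactness. That both indices are positive matters below, where index \<open>0\<close> is the
  largest value.
\<close>

lemma bounded_seq_close_pair:
  fixes x :: "nat \<Rightarrow> real"
  assumes "\<And>n. x n \<in> {l..u}" "0 < e"
  obtains m n where "1 \<le> m" "m < n" "\<bar>x m - x n\<bar> < e"
proof -
  obtain z r where r: "strict_mono r" "(x \<circ> r) \<longlonglongrightarrow> z"
    using compact_Icc[of l u] assms(1) unfolding compact_def by meson
  then obtain N where N: "\<And>m n. m \<ge> N \<Longrightarrow> n \<ge> N \<Longrightarrow> dist ((x \<circ> r) m) ((x \<circ> r) n) < e"
    using LIMSEQ_imp_Cauchy[OF r(2)] assms(2) unfolding Cauchy_def by blast
  have "r N < r (Suc N)" "r (Suc N) < r (Suc (Suc N))"
    using r(1) by (auto simp: strict_mono_def)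
  moreover have "\<bar>x (r (Suc N)) - x (r (Suc (Suc N)))\<bar> < e"
    using N[of "Suc N" "Suc (Suc N)"] by (simp add: dist_real_def)
  ultimately show ?thesis
    using that[of "r (Suc N)" "r (Suc (Suc N))"] by simp
qed

text \<open>
  The abstract reason for finiteness. Think of \<open>x\<close> as an orbit that starts at its maximum \<open>x 0\<close>,
  of a map under which close values come from values that are in the same order and at least as
  close; \<open>x 1\<close> has a gap of length \<open>e\<close> above it. If all values are distinct, there are arbitrarily close pairs \<open>x n < x k\<close>.
  Going back along both orbits keeps the pair close. It ends either at \<open>x 1\<close>, which the gap
  excludes, or at \<open>x 0\<close>. In the second case \<open>k < n\<close>, and the positive index \<open>n - k\<close> gives a value as
  close to the maximum \<open>x 0\<close>. Hence values at positive indices come arbitrarily close to \<open>x 0\<close>. The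
  first one that is close, at index \<open>p\<close>, has a yet closer value at a later index \<open>q\<close> above it; this pair
  goes back to \<open>x 1\<close>, a contradiction.
\<close>

lemma not_inj_if_gap:
  fixes x :: "nat \<Rightarrow> real"
  assumes bounds: "\<And>n. x n \<in> {l..x 0}" and e: "0 < e"
    and gap: "\<And>k. \<not> (x 1 < x k \<and> x k < x 1 + e)"
    and step_back: "\<And>n k. x (Suc n) < x (Suc k) \<Longrightarrow> x (Suc k) < x (Suc n) + e \<Longrightarrow>
      x n < x k \<and> x k - x n \<le> x (Suc k) - x (Suc n)"
  shows "\<not> inj x"
proof
  assume inj: "inj x"
  \<comment> \<open>The pair goes back to \<open>x 1\<close>.\<close>
  have up: "\<not> (x n < x k \<and> x k < x n + e)" if "1 \<le> n" "n \<le> k" for n k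
    using that
  proof (induction n arbitrary: k rule: dec_induct)
    case base
    show ?case by (rule gap)
  next
    case (step n)
    then obtain j where "k = Suc j" "n \<le> j"
      by (cases k) auto
    then show ?case
      using step.IH[of j] step_back[of n j] by force
  qed
  \<comment> \<open>The pair goes back to \<open>x 0\<close>.\<close>
  have down: "x 0 - x (n - k) \<le> x k - x n" if "k \<le> n" "x n < x k" "x k < x n + e" for n k
    using that
  proof (induction k arbitrary: n)
    case (Suc k)
    then obtain j where "n = Suc j" "k \<le> j"
      by (cases n) auto
    then show ?case
      using Suc.IH[of j] Suc.prems step_back[of j k] by force
  qed simp
  have near: "\<exists>p\<ge>1. x 0 - x p < d" if d: "0 < d" "d \<le> e" for d
  proof -
    obtain m n where mn: "1 \<le> m" "m < n" "\<bar>x m - x n\<bar> < d"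
      using bounded_seq_close_pair[of x l "x 0" d] bounds d by blast
    have "x m \<noteq> x n"
      using inj mn by (auto dest: injD)
    moreover have "\<not> x m < x n"
      using up[of m n] mn d by auto
    ultimately have "x 0 - x (n - m) \<le> x m - x n"
      using down[of m n] mn d by auto
    then show ?thesis
      using mn by (intro exI[of _ "n - m"]) auto
  qed
  define p where "p = (LEAST p. 1 \<le> p \<and> x 0 - x p < e)"
  have "\<exists>p. 1 \<le> p \<and> x 0 - x p < e"
    using near[of e] e by blast
  then have p: "1 \<le> p" "x 0 - x p < e"
    unfolding p_def by (metis (mono_tags, lifting) LeastI_ex)+
  have least: "p \<le> q" if "1 \<le> q" "x 0 - x q < e" for q
    using that unfolding p_def by (auto intro: Least_le)
  have "x p \<noteq> x 0"
    using p inj by (auto dest: injD)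
  then have "x p < x 0"
    using bounds[of p] by auto
  then obtain q where q: "1 \<le> q" "x 0 - x q < x 0 - x p"
    using near[of "x 0 - x p"] p(2) by auto
  have "p \<le> q"
    using least[of q] q p by auto
  moreover have "x q < x p + e"
    using bounds[of q] p by auto
  ultimately show False
    using up[of p q] p q by auto
qed

text \<open>
  The low branch expands, having derivative \<open>1 / (1 - x)\<^sup>2 \<ge> 1\<close>.
\<close>

lemma euclid_step_low_diff:
  assumes "x \<le> y" "y < 1" "0 \<le> x"
  shows "y - x \<le> euclid_step y - euclid_step x"
proof -
  have "(1 - x) * (1 - y) \<le> 1 * 1"
    using assms by (intro mult_mono) auto
  then have "(y - x) * ((1 - x) * (1 - y)) \<le> (y - x) * 1"
    using assms by (intro mult_left_mono) auto
  then have "y - x \<le> (y - x) / ((1 - x) * (1 - y))"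
    using assms by (simp add: pos_le_divide_eq)
  moreover have "euclid_step y - euclid_step x = (y - x) / ((1 - x) * (1 - y))"
    using assms by (simp add: euclid_step_def field_simps)
  ultimately show ?thesis
    by simp
qed

context interior_params
begin

lemma euclid_step_high_le:
  assumes "1 \<le> x" "x \<le> apex"
  shows "euclid_step x \<le> apex - 1"
  using assms by (simp add: euclid_step_def)

text \<open>
  The images of the two branches lie on different sides of \<open>- 1 / a - 1\<close>, the image of \<open>- 1 / a\<close>, and
  the excess \<open>b - a - 1\<close> separates them. This is where distance from the line \<open>b = a + 1\<close> counts.
\<close>

lemma euclid_step_low_ge:
  assumes "b \<le> x" "x < 1"
  shows "apex - 1 + (b - a - 1) \<le> euclid_step x"
proof -
  define p where "p = (1 - x) * - a"
  have "0 < p"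
    using assms a_neg unfolding p_def by (intro mult_pos_pos) auto
  moreover have "p \<le> 1 * 1"
    using assms a_neg a_gt b_pos unfolding p_def by (intro mult_mono) auto
  moreover have w: "0 \<le> x - a - 1"
    using assms width by simp
  ultimately have "x - a - 1 \<le> (x - a - 1) / p"
    by (simp add: pos_le_divide_eq mult_left_le)
  moreover have "euclid_step x - (apex - 1) = (x - a - 1) / p"
    using assms a_neg by (simp add: euclid_step_def field_simps p_def)
  ultimately show ?thesis
    using assms by linarith
qed

lemma settled_if_width_gt_1:
  assumes "b \<noteq> a + 1"
  shows "settled a b"
proof (cases trapped)
  case False
  then show ?thesis
    using cycle_if_not_trapped by (simp add: settled_def)
next
  case True
  define x where "x n = (euclid_step ^^ n) apex" for n
  have x0: "x 0 = apex" and xS: "x (Suc n) = euclid_step (x n)" for n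
    by (simp_all add: x_def)
  have range: "x n \<in> {b..apex}" for n
    using trapped_range[OF True] by (simp add: x_def)
  have x1: "x 1 = apex - 1"
    using xS[of 0] x0 apex_gt_1 by (simp add: euclid_step_def)
  define e where "e = min 1 (b - a - 1)"
  have e: "0 < e" "e \<le> 1" "e \<le> b - a - 1"
    using assms width by (auto simp: e_def)
  have high: "x (Suc n) \<le> x 1" if "1 \<le> x n" for n
    using that range euclid_step_high_le[of "x n"] unfolding xS x1 by auto
  have low: "x 1 + e \<le> x (Suc n)" if "x n < 1" for n
    using that range euclid_step_low_ge[of "x n"] e unfolding xS x1 by fastforce
  have "\<not> inj x"
  proof (rule not_inj_if_gap[where l = b and e = e])
    show "x n \<in> {b..x 0}" for n
      using range by (simp add: x0)
    show "\<not> (x 1 < x k \<and> x k < x 1 + e)" for k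
    proof (cases k)
      case 0
      then show ?thesis
        using x0 x1 e by simp
    next
      case (Suc j)
      then show ?thesis
        using high[of j] low[of j] by (cases "x j < 1") auto
    qed
    show "x n < x k \<and> x k - x n \<le> x (Suc k) - x (Suc n)"
      if lt: "x (Suc n) < x (Suc k)" "x (Suc k) < x (Suc n) + e" for n k
    proof -
      consider "x n < 1" "1 \<le> x k" | "1 \<le> x n" "x k < 1" | "1 \<le> x n" "1 \<le> x k"
        | "x n < 1" "x k < 1"
        by linarith
      then show ?thesis
      proof cases
        case 1
        then show ?thesis
          using high[of k] low[of n] lt e by linarith
      next
        case 2
        then show ?thesis
          using high[of n] low[of k] lt by linarith
      next
        case 3
        then show ?thesis
          using lt by (simp add: xS euclid_step_def)
      next
        case 4
        have pos: "0 \<le> x n" "0 \<le> x k"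
          using range[of n] range[of k] b_pos by auto
        have "x n < x k"
          using euclid_step_low_diff[of "x k" "x n"] 4 pos lt unfolding xS by linarith
        then show ?thesis
          using euclid_step_low_diff[of "x n" "x k"] 4 pos unfolding xS by auto
      qed
    qed
  qed (use e in auto)
  then obtain p q where "p < q" "x p = x q"
    unfolding inj_def by (metis linorder_neqE_nat)
  then show ?thesis
    using settled_if_periodic[OF True] by (simp add: x_def)
qed

end

lemma settled_if_le_minus_1:
  assumes "a \<le> - 1" "0 < b" "- a * b \<le> 1"
  shows "settled a b"
proof -
  have b1: "b \<le> - 1 / a"
    using assms by (simp add: field_simps)
  have "\<exists>m k. upper_orbit_a a b m = lower_orbit_a a b k"
  proof (cases "a = - 1")
    case True
    then have "upper_orbit_a a b 1 = lower_orbit_a a b 0"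
      using assms by (simp add: upper_orbit_a_def lower_orbit_a_def ab_map_def)
    then show ?thesis by blast
  next
    case False
    with assms have a: "a < - 1" by simp
    have "- 1 / a < 1"
      using a by (simp add: field_simps)
    moreover have "0 < - 1 / a"
      using a by (simp add: field_simps)
    moreover define v where "v = - 1 / a - 1"
    ultimately have v: "- 1 < v" "v < 0"
      by auto
    have u0: "upper_orbit_a a b 0 = Fin (- 1 / a)"
      using a by (simp add: upper_orbit_a_def)
    have u1: "upper_orbit_a a b 1 = Fin v"
      using u0 b1 a assms v by (simp add: upper_orbit_a_def ab_map_def v_def)
    have u2: "upper_orbit_a a b 2 = Fin (- 1 / v)"
      using u1 a assms v by (simp add: upper_orbit_a_def ab_map_def eval_nat_numeral)
    have b: "b \<le> 1"
      using b1 \<open>- 1 / a < 1\<close> by simp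
    have "1 < - 1 / v"
      using v by (simp add: field_simps)
    then have u3: "upper_orbit_a a b 3 = Fin (- 1 / v - 1)"
      using u2 b a assms by (simp add: upper_orbit_a_def ab_map_def eval_nat_numeral)
    have l0: "lower_orbit_a a b 0 = Fin (a + 1)"
      by (simp add: lower_orbit_a_def)
    have l1: "lower_orbit_a a b 1 = Fin (- 1 / (a + 1))"
      using l0 a assms by (simp add: lower_orbit_a_def ab_map_lower_def)
    have "- 1 / v - 1 = - 1 / (a + 1)"
      unfolding v_def using a v by (simp add: field_simps)
    then show ?thesis
      using u3 l1 by metis
  qed
  then show ?thesis
    by (simp add: settled_def cycle_property_def)
qed

lemma settled_off_boundary:
  assumes "(a, b) \<in> param_set" "a \<noteq> 0" "b \<noteq> 0" "b \<noteq> a + 1"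
  shows "settled a b"
proof (cases "a \<le> - 1")
  case True
  then show ?thesis
    using settled_if_le_minus_1 assms by (auto simp: param_set_def)
next
  case False
  then interpret interior_params a b
    using assms by unfold_locales (auto simp: param_set_def)
  show ?thesis
    by (rule settled_if_width_gt_1) fact
qed

lemma param_set_neg: "(a, b) \<in> param_set \<Longrightarrow> (- b, - a) \<in> param_set"
  by (auto simp: param_set_def mult.commute)

lemma finiteness_off_boundary:
  assumes "(a, b) \<in> param_set" "nondegenerate a b" "b \<noteq> a + 1"
  shows "finiteness_condition a b"
proof -
  have "a \<le> b" "a \<noteq> 0" "b \<noteq> 0"
    using assms by (auto simp: param_set_def nondegenerate_def)
  then show ?thesis
    using finiteness_condition_iff_settled settled_off_boundary[of a b]
      settled_off_boundary[of "- b" "- a"] param_set_neg[OF assms(1)] assms by auto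
qed

section \<open>Exceptions lie on the boundary\<close>

lemma exception_imp_boundary:
  assumes "(a, b) \<in> exceptions"
  shows "b = a + 1" "- 1 < a" "a < 0"
proof -
  have p: "(a, b) \<in> param_set" "a \<noteq> 0" "b \<noteq> 0" "\<not> finiteness_condition a b"
    using assms by (auto simp: exceptions_def nondegenerate_def)
  show "b = a + 1"
    using assms finiteness_off_boundary by (auto simp: exceptions_def)
  then show "- 1 < a" "a < 0"
    using p by (auto simp: param_set_def)
qed

lemma interior_params_boundary: "- 1 < a \<Longrightarrow> a < 0 \<Longrightarrow> interior_params a (a + 1)"
proof unfold_locales
  assume a: "- 1 < a" "a < 0"
  then have "- a * (a + 1) \<le> 1 * 1"
    by (intro mult_mono) auto
  then show "- a * (a + 1) \<le> 1" by simp
qed auto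

text \<open>
  Points \<open>(a, a + 1 - \<epsilon>)\<close> violate \<open>b - a \<ge> 1\<close>.
\<close>

lemma boundary_in_frontier:
  assumes "(a, a + 1) \<in> param_set"
  shows "(a, a + 1) \<in> frontier param_set"
proof -
  have "(a, a + 1) \<notin> interior param_set"
  proof
    assume "(a, a + 1) \<in> interior param_set"
    then obtain e where e: "0 < e" "ball (a, a + 1) e \<subseteq> param_set"
      by (auto simp: mem_interior)
    have "(a, a + 1 - e / 2) \<in> ball (a, a + 1) e"
      using e by (simp add: dist_Pair_Pair dist_real_def)
    then show False
      using e by (auto simp: param_set_def)
  qed
  then show ?thesis
    using assms closure_subset by (auto simp: frontier_def)
qed

section \<open>Exceptions form a null set\<close>

text \<open>
  Markov's inequality in the case of integral \<open>0\<close>.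
\<close>

lemma negligible_if_integral_zero:
  fixes p :: "real \<Rightarrow> real"
  assumes S: "S \<in> lmeasurable" and p: "p integrable_on S" "integral S p \<le> 0"
    and c: "0 < c" "\<And>x. x \<in> S \<Longrightarrow> c \<le> p x"
  shows "negligible S"
proof -
  have "c * measure lebesgue S = integral S (\<lambda>x. c * 1)"
    using lmeasure_integral[OF S] by (simp only: integral_mult_right)
  also have "\<dots> = integral S (\<lambda>x. c)"
    by simp
  also have "\<dots> \<le> integral S p"
    using p c integrable_on_const[OF S] by (intro integral_le) auto
  finally have "c * measure lebesgue S \<le> 0"
    using p(2) by linarith
  then have "measure lebesgue S \<le> 0"
    using c(1) by (simp add: mult_le_0_iff)
  then show ?thesis
    using negligible_iff_measure0[OF S] measure_nonneg[of lebesgue S] by simp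
qed

text \<open>
  The infinite measure \<open>dx / x\<close> on the positive half-line is invariant under the Euclidean step: the
  preimages of \<open>x\<close> are \<open>x + 1\<close> and \<open>x / (1 + x)\<close>, and they contribute the two terms of
  \<open>1 / x = 1 / (x + 1) + 1 / (x (x + 1))\<close>. Since \<open>K\<close> is forward invariant and has finite
  measure, it must equal its preimage up to a null set, so almost every point of \<open>K\<close> stays in
  \<open>K\<close> under translation by \<open>1\<close>, hence under translation by any natural number. As
  \<open>K\<close> is bounded, it is null.
\<close>

lemma euclid_invariant_negligible:
  assumes K: "K \<in> sets borel" "K \<subseteq> {l..u}" "0 < l"
    and inv: "\<And>x. x \<in> K \<Longrightarrow> euclid_step x \<in> K"
  shows "negligible K"
proof -
  define A where "A = {x \<in> K. x + 1 \<in> K}"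
  define B where "B = {x \<in> K. x / (1 + x) \<in> K}"
  have sub: "A \<subseteq> K" "B \<subseteq> K"
    by (auto simp: A_def B_def)
  have pos: "0 < x" if "x \<in> K" for x
    using that K by auto
  have "A = K \<inter> (\<lambda>x. x + 1) -` K" "B = K \<inter> (\<lambda>x. x / (1 + x)) -` K"
    by (auto simp: A_def B_def)
  moreover have "(\<lambda>x::real. x + 1) -` K \<in> sets borel"
    using measurable_sets[of "\<lambda>x::real. x + 1" borel borel K] K by simp
  moreover have "(\<lambda>x::real. x / (1 + x)) -` K \<in> sets borel"
    using measurable_sets[of "\<lambda>x::real. x / (1 + x)" borel borel K] K by simp
  ultimately have borel: "A \<in> sets borel" "B \<in> sets borel"
    using K by auto
  have leb: "S \<in> sets lebesgue" if "S \<in> sets borel" for S :: "real set"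
    using that by (simp add: sets_completionI_sets)
  have ai: "f absolutely_integrable_on S"
    if "continuous_on {l..u} f" "S \<in> sets borel" "S \<subseteq> K" for f :: "real \<Rightarrow> real" and S
    using set_integrable_subset[OF absolutely_integrable_continuous_real[OF that(1)]]
      leb[OF that(2)] that(3) K by blast
  have io: "f integrable_on S"
    if "continuous_on {l..u} f" "S \<in> sets borel" "S \<subseteq> K" for f :: "real \<Rightarrow> real" and S
    using ai[OF that] by (rule set_lebesgue_integral_eq_integral(1))
  have cont: "continuous_on {l..u} (\<lambda>x. 1 / x)" "continuous_on {l..u} (\<lambda>x. 1 / (x + 1))"
    "continuous_on {l..u} (\<lambda>x. 1 / (x * (x + 1)))"
    using K(3) by (auto intro!: continuous_intros)
  have K_eq: "K = (\<lambda>x. x + 1) ` A \<union> (\<lambda>x. x / (1 + x)) ` B"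
  proof (intro equalityI subsetI)
    fix x assume x: "x \<in> K"
    show "x \<in> (\<lambda>x. x + 1) ` A \<union> (\<lambda>x. x / (1 + x)) ` B"
    proof (cases "x < 1")
      case True
      define y where "y = euclid_step x"
      have "y \<in> K"
        using inv[OF x] by (simp add: y_def)
      moreover have "y / (1 + y) = x"
        using True by (simp add: y_def euclid_step_def field_simps)
      ultimately show ?thesis
        using x unfolding B_def by force
    next
      case False
      then have "x - 1 \<in> K"
        using inv[OF x] by (simp add: euclid_step_def)
      then show ?thesis
        using x unfolding A_def by force
    qed
  qed (auto simp: A_def B_def)
  have intA: "integral ((\<lambda>x. x + 1) ` A) (\<lambda>x. 1 / x) = integral A (\<lambda>x. 1 / (x + 1))"
    and ioA: "(\<lambda>x. 1 / x) integrable_on ((\<lambda>x. x + 1) ` A)"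
  proof -
    have "(\<lambda>x::real. \<bar>1\<bar> * (1 / (x + 1))) absolutely_integrable_on A \<and>
        integral A (\<lambda>x. \<bar>1\<bar> * (1 / (x + 1))) = integral A (\<lambda>x. 1 / (x + 1)) \<longleftrightarrow>
      (\<lambda>x. 1 / x) absolutely_integrable_on ((\<lambda>x. x + 1) ` A) \<and>
        integral ((\<lambda>x. x + 1) ` A) (\<lambda>x. 1 / x) = integral A (\<lambda>x. 1 / (x + 1))"
      using leb[OF borel(1)]
      by (intro has_absolute_integral_change_of_variables_1')
         (auto intro!: derivative_eq_intros)
    then show "integral ((\<lambda>x. x + 1) ` A) (\<lambda>x. 1 / x) = integral A (\<lambda>x. 1 / (x + 1))"
      "(\<lambda>x. 1 / x) integrable_on ((\<lambda>x. x + 1) ` A)"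
      using ai[OF cont(2) borel(1) sub(1)] set_lebesgue_integral_eq_integral(1) by auto
  qed
  have intB: "integral ((\<lambda>x. x / (1 + x)) ` B) (\<lambda>x. 1 / x) = integral B (\<lambda>x. 1 / (x * (x + 1)))"
    and ioB: "(\<lambda>x. 1 / x) integrable_on ((\<lambda>x. x / (1 + x)) ` B)"
  proof -
    let ?J = "\<lambda>x::real. \<bar>1 / (1 + x)\<^sup>2\<bar> * (1 / (x / (1 + x)))"
    have J: "?J x = 1 / (x * (x + 1))" if "x \<in> B" for x
    proof -
      have "0 < x"
        using pos that sub by blast
      then show ?thesis
        by (simp add: divide_simps power2_eq_square)
    qed
    have "inj_on (\<lambda>x. x / (1 + x)) B"
    proof (rule inj_onI)
      fix x y assume xy: "x \<in> B" "y \<in> B" "x / (1 + x) = y / (1 + y)"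
      then have "0 < x" "0 < y"
        using pos sub by auto
      then show "x = y"
        using xy(3) by (simp add: frac_eq_eq algebra_simps)
    qed
    moreover have "((\<lambda>x. x / (1 + x)) has_field_derivative 1 / (1 + x)\<^sup>2) (at x within B)"
      if "x \<in> B" for x
      using pos[of x] that sub
      by (auto intro!: derivative_eq_intros simp: power2_eq_square)
    ultimately have "?J absolutely_integrable_on B \<and> integral B ?J = integral B ?J \<longleftrightarrow>
      (\<lambda>x. 1 / x) absolutely_integrable_on ((\<lambda>x. x / (1 + x)) ` B) \<and>
        integral ((\<lambda>x. x / (1 + x)) ` B) (\<lambda>x. 1 / x) = integral B ?J"
      using leb[OF borel(2)] by (intro has_absolute_integral_change_of_variables_1') auto
    moreover have "?J absolutely_integrable_on B"
      using ai[OF cont(3) borel(2) sub(2)] J set_integrable_cong[of lebesgue lebesgue B B ?J] by simp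
    moreover have "integral B ?J = integral B (\<lambda>x. 1 / (x * (x + 1)))"
      using J by (rule integral_cong)
    ultimately show "integral ((\<lambda>x. x / (1 + x)) ` B) (\<lambda>x. 1 / x) = integral B (\<lambda>x. 1 / (x * (x + 1)))"
      "(\<lambda>x. 1 / x) integrable_on ((\<lambda>x. x / (1 + x)) ` B)"
      using set_lebesgue_integral_eq_integral(1) by auto
  qed
  have "x + 1 \<noteq> y / (1 + y)" if "x \<in> A" "y \<in> B" for x y
  proof -
    have "1 < x + 1" "y / (1 + y) < 1"
      using pos[of x] pos[of y] that sub by auto
    then show ?thesis by simp
  qed
  then have disj: "(\<lambda>x. x + 1) ` A \<inter> (\<lambda>x. x / (1 + x)) ` B = {}"
    by blast
  have "integral K (\<lambda>x. 1 / x) = integral A (\<lambda>x. 1 / (x + 1)) + integral B (\<lambda>x. 1 / (x * (x + 1)))"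
    using integral_Un[OF ioA ioB] disj intA intB K_eq by simp
  moreover have "integral K (\<lambda>x. 1 / x) =
      integral K (\<lambda>x. 1 / (x + 1)) + integral K (\<lambda>x. 1 / (x * (x + 1)))"
  proof -
    have "1 / x = 1 / (x + 1) + 1 / (x * (x + 1))" if "x \<in> K" for x
      using pos[OF that] by (simp add: divide_simps)
    then have "integral K (\<lambda>x. 1 / x) = integral K (\<lambda>x. 1 / (x + 1) + 1 / (x * (x + 1)))"
      by (rule integral_cong)
    also have "\<dots> = integral K (\<lambda>x. 1 / (x + 1)) + integral K (\<lambda>x. 1 / (x * (x + 1)))"
      using K by (intro integral_add io cont) auto
    finally show ?thesis .
  qed
  moreover have "integral B (\<lambda>x. 1 / (x * (x + 1))) \<le> integral K (\<lambda>x. 1 / (x * (x + 1)))"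
    using K borel sub by (intro integral_subset_le io cont) (auto dest!: pos)
  moreover have "integral K (\<lambda>x. 1 / (x + 1)) =
      integral (K - A) (\<lambda>x. 1 / (x + 1)) + integral A (\<lambda>x. 1 / (x + 1))"
  proof -
    have "integral ((K - A) \<union> A) (\<lambda>x. 1 / (x + 1)) =
        integral (K - A) (\<lambda>x. 1 / (x + 1)) + integral A (\<lambda>x. 1 / (x + 1))"
      using K borel sub Diff_disjoint[of A K] by (intro integral_Un io cont) (auto simp: Int_commute)
    then show ?thesis
      using sub by (simp add: Un_absorb2)
  qed
  ultimately have "integral (K - A) (\<lambda>x. 1 / (x + 1)) \<le> 0"
    by linarith
  have "K - A \<in> lmeasurable"
    using K borel leb by (intro bounded_set_imp_lmeasurable)
      (auto intro: bounded_subset[OF bounded_closed_interval])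
  moreover have "(\<lambda>x. 1 / (x + 1)) integrable_on (K - A)"
    using K borel by (intro io cont) auto
  moreover have "1 / (u + 1) \<le> 1 / (x + 1)" if "x \<in> K - A" for x
    using that K by (intro divide_left_mono) (auto intro!: mult_pos_pos)
  moreover have "0 < 1 / (u + 1)" if "K \<noteq> {}"
    using that K by fastforce
  ultimately have null: "negligible (K - A)"
    using negligible_if_integral_zero[of "K - A" "\<lambda>x. 1 / (x + 1)" "1 / (u + 1)"]
      \<open>integral (K - A) (\<lambda>x. 1 / (x + 1)) \<le> 0\<close> by (cases "K = {}") simp_all
  \<comment> \<open>The points that leave \<open>K\<close> at the last of \<open>n + 1\<close> unit translations are a translate of part of \<open>K - A\<close>.\<close>
  have shift: "negligible {x \<in> K. x + real n \<notin> K}" for n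
  proof (induction n)
    case (Suc n)
    have "{x \<in> K. x + real (Suc n) \<notin> K} \<subseteq> {x \<in> K. x + real n \<notin> K} \<union> (+) (- real n) ` (K - A)"
    proof
      fix x assume "x \<in> {x \<in> K. x + real (Suc n) \<notin> K}"
      moreover have "x + real (Suc n) = x + real n + 1"
        by simp
      ultimately have x: "x \<in> K \<and> x + real n + 1 \<notin> K"
        by (simp only: mem_Collect_eq simp_thms)
      then have "x + real n \<in> K \<Longrightarrow> x + real n \<in> K - A"
        unfolding A_def by blast
      moreover have "x = (+) (- real n) (x + real n)"
        by simp
      ultimately show "x \<in> {x \<in> K. x + real n \<notin> K} \<union> (+) (- real n) ` (K - A)"
        using x by blast
    qed
    then show ?case
      using Suc negligible_translation[OF null] by (meson negligible_Un negligible_subset)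
  qed simp
  obtain n :: nat where n: "u < real n"
    using reals_Archimedean2 by blast
  have "{x \<in> K. x + real n \<notin> K} = K"
    using n K pos by fastforce
  then show ?thesis
    using shift[of n] by simp
qed

definition trap :: "nat \<Rightarrow> real set" where
  "trap N = {x. \<forall>n. (euclid_step ^^ n) x \<in> {1 / real (Suc N)..real (Suc N)}}"

lemma negligible_trap: "negligible (trap N)"
proof (rule euclid_invariant_negligible)
  have [measurable]: "euclid_step \<in> borel_measurable borel"
    unfolding euclid_step_def by measurable
  have "(euclid_step ^^ n) \<in> borel_measurable borel" for n
    by (rule measurable_compose_n) measurable
  then have "(euclid_step ^^ n) -` {1 / real (Suc N)..real (Suc N)} \<in> sets borel" for n
    using measurable_sets[of "euclid_step ^^ n" borel borel "{1 / real (Suc N)..real (Suc N)}"] by simp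
  moreover have "trap N = (\<Inter>n. (euclid_step ^^ n) -` {1 / real (Suc N)..real (Suc N)})"
    by (auto simp: trap_def)
  ultimately show "trap N \<in> sets borel"
    by auto
  show "trap N \<subseteq> {1 / real (Suc N)..real (Suc N)}"
    unfolding trap_def by (auto dest: spec[of _ 0])
  show "euclid_step x \<in> trap N" if "x \<in> trap N" for x
    using that unfolding trap_def mem_Collect_eq by (metis funpow_Suc_right comp_apply)
qed simp

text \<open>
  The interval \<open>[b, - 1 / a]\<close> that contains the orbit varies with the parameters; countably many
  fixed intervals exhaust the possibilities.
\<close>

lemma (in interior_params) apex_in_trap:
  assumes trapped
  shows "apex \<in> (\<Union>N. trap N)"
proof -
  obtain N where N: "max apex (1 / b) < real N"
    using reals_Archimedean2 by blast
  have "1 / real (Suc N) \<le> b"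
    using N b_pos by (simp add: field_simps)
  then have "(euclid_step ^^ n) apex \<in> {1 / real (Suc N)..real (Suc N)}" for n
    using trapped_range[OF assms, of n] N by auto
  then show ?thesis
    unfolding trap_def by blast
qed

lemma unsettled_in_trap:
  assumes "- 1 < a" "a < 0" "\<not> settled a (a + 1)"
  shows "- 1 / a \<in> (\<Union>N. trap N)"
proof -
  interpret interior_params a "a + 1"
    using assms interior_params_boundary by blast
  show ?thesis
    using apex_in_trap cycle_if_not_trapped assms by (auto simp: settled_def)
qed

text \<open>
  On the line, \<open>a = t\<close> contributes the starting point \<open>- 1 / t\<close>, and \<open>b = t + 1\<close> by reflection the
  starting point \<open>1 / (t + 1)\<close>. Conversely \<open>t\<close> is a differentiable function of either starting
  point, and such functions preserve null sets.
\<close>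

lemma null_exceptions: "null_on_boundary_line exceptions"
proof -
  define P where "P = (\<Union>N. trap N)"
  have "negligible P"
    unfolding P_def by (intro negligible_Union_nat negligible_trap)
  moreover have pos: "0 < x" if "x \<in> P" for x
  proof -
    have "1 / real (Suc N) \<le> x" if "x \<in> trap N" for N
      using that unfolding trap_def by (auto dest: spec[of _ 0])
    then show ?thesis
      using that unfolding P_def by (metis UN_E less_le_trans of_nat_0_less_iff zero_less_Suc zero_less_divide_1_iff)
  qed
  ultimately have neg: "negligible ((\<lambda>x. - 1 / x) ` P)" "negligible ((\<lambda>x. 1 / x - 1) ` P)"
    by (force intro!: negligible_differentiable_image_negligible derivative_intros
        simp: differentiable_on_def dest: pos)+
  have "{t. (t, t + 1) \<in> exceptions} \<subseteq> (\<lambda>x. - 1 / x) ` P \<union> (\<lambda>x. 1 / x - 1) ` P"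
  proof
    fix t assume "t \<in> {t. (t, t + 1) \<in> exceptions}"
    then have t: "(t, t + 1) \<in> exceptions" "- 1 < t" "t < 0"
      using exception_imp_boundary[of t "t + 1"] by auto
    then have "\<not> settled t (t + 1) \<or> \<not> settled (- (t + 1)) (- t)"
      using finiteness_condition_iff_settled[of t "t + 1"] by (auto simp: exceptions_def)
    then show "t \<in> (\<lambda>x. - 1 / x) ` P \<union> (\<lambda>x. 1 / x - 1) ` P"
    proof
      assume "\<not> settled t (t + 1)"
      then have "- 1 / t \<in> P"
        using unsettled_in_trap t unfolding P_def by blast
      moreover have "t = - 1 / (- 1 / t)"
        using t by simp
      ultimately show ?thesis by blast
    next
      assume "\<not> settled (- (t + 1)) (- t)"
      then have "- 1 / - (t + 1) \<in> P"
        using unsettled_in_trap[of "- (t + 1)"] t unfolding P_def by simp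
      moreover have "t = 1 / (- 1 / - (t + 1)) - 1"
        using t by simp
      ultimately show ?thesis by blast
    qed
  qed
  then have "negligible {t. (t, t + 1) \<in> exceptions}"
    using neg by (meson negligible_Un negligible_subset)
  then show ?thesis
    by (simp add: null_on_boundary_line_def negligible_iff_null_sets)
qed

section \<open>Uncountably many exceptions\<close>

context interior_params
begin

text \<open>
  The Euclidean orbit is trapped and never returns. Listing the points that
  \<open>high_step\<close> and \<open>low_step\<close> pass through shows that the upper orbit stays in
  \<open>(a, 0) \<union> (b, \<infinity>)\<close> and the lower one in \<open>(- \<infinity>, a] \<union> (0, b]\<close>, so they cannot meet. The strict
  bound by \<open>b\<close> holds because on the line \<open>b = a + 1\<close> the points \<open>b\<close> and \<open>- 1 / a\<close> have the same
  image, so an orbit through \<open>b\<close> would be periodic.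
\<close>

lemma not_settled_if_inj:
  assumes b: "b = a + 1" and trapped and inj: "inj (\<lambda>n. (euclid_step ^^ n) apex)"
  shows "\<not> settled a b"
proof -
  define x where "x n = (euclid_step ^^ n) apex" for n
  have x0: "x 0 = apex" and xS: "x (Suc n) = euclid_step (x n)" for n
    by (simp_all add: x_def)
  have range: "x n \<in> {b..apex}" for n
    using trapped_range[OF \<open>trapped\<close>] by (simp add: x_def)
  have inj_x: "inj x"
    using inj by (simp add: inj_def x_def)
  have hole: "x n \<notin> hole" for n
    using \<open>trapped\<close> by (simp add: x_def trapped_def)
  have b1: "b < 1"
    using a_neg b by simp
  have x1: "x 1 = apex - 1"
    using xS[of 0] x0 apex_gt_1 by (simp add: euclid_step_def)
  have gt_b: "b < x n" for n
  proof -
    have "x n \<noteq> b"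
    proof
      assume eq: "x n = b"
      have "euclid_step b = apex - 1"
        using b a_neg a_gt by (simp add: euclid_step_def field_simps)
      then have "x (Suc n) = x 1"
        using eq xS x1 by simp
      then have "n = 0"
        using injD[OF inj_x, of "Suc n" 1] by simp
      then show False
        using eq x0 apex_gt_1 b1 by simp
    qed
    then show ?thesis
      using range[of n] by auto
  qed
  have upper: "\<exists>n z. upper_orbit_a a b i = Fin z \<and>
      (z = x n \<or> x n < 1 \<and> (z = x n - 1 \<or> z = 1 / (1 - x n)))" for i
  proof (induction i)
    case 0
    have "upper_orbit_a a b 0 = Fin (x 0)"
      by (simp add: x0 upper_orbit_a_apex)
    then show ?case
      by blast
  next
    case (Suc i)
    then obtain n z where z: "upper_orbit_a a b i = Fin z"
      "z = x n \<or> x n < 1 \<and> (z = x n - 1 \<or> z = 1 / (1 - x n))"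
      by blast
    have "upper_orbit_a a b (Suc i) = ab_map a b (Fin z)"
      using z(1) by (simp add: upper_orbit_a_apex)
    moreover from hole[of n]
    have "\<exists>m y. ab_map a b (Fin z) = Fin y \<and>
        (y = x m \<or> x m < 1 \<and> (y = x m - 1 \<or> y = 1 / (1 - x m)))"
    proof (cases rule: not_hole_cases)
      case low
      have "b \<le> x n"
        using gt_b[of n] by simp
      note s = low_step[OF this low(1), folded xS]
      from z(2) s(2-4) low(2) show ?thesis
        by metis
    next
      case high
      have "x n \<le> apex"
        using range[of n] by simp
      from z(2) high_step(2)[OF high(1) this, folded xS] high(2) show ?thesis
        by (metis less_asym)
    qed
    ultimately show ?case
      by metis
  qed
  have lower: "\<exists>n z. lower_orbit_a a b i = Fin z \<and>
      (z = 1 - 1 / x n \<or> 1 < x n \<and> (z = - x n / (x n - 1) \<or> z = - 1 / (x n - 1)))" for i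
  proof (induction i)
    case 0
    have "lower_orbit_a a b 0 = Fin (1 - 1 / x 0)"
      by (simp add: x0 lower_orbit_a_apex)
    then show ?case
      by blast
  next
    case (Suc i)
    then obtain n z where z: "lower_orbit_a a b i = Fin z"
      "z = 1 - 1 / x n \<or> 1 < x n \<and> (z = - x n / (x n - 1) \<or> z = - 1 / (x n - 1))"
      by blast
    have "lower_orbit_a a b (Suc i) = ab_map_lower a b (Fin z)"
      using z(1) by (simp add: lower_orbit_a_apex)
    moreover from hole[of n]
    have "\<exists>m y. ab_map_lower a b (Fin z) = Fin y \<and>
        (y = 1 - 1 / x m \<or> 1 < x m \<and> (y = - x m / (x m - 1) \<or> y = - 1 / (x m - 1)))"
    proof (cases rule: not_hole_cases)
      case low
      have "b \<le> x n"
        using gt_b[of n] by simp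
      from z(2) low_step(6)[OF this low(1), folded xS] low(2) show ?thesis
        by (metis less_asym)
    next
      case high
      have "x n \<le> apex"
        using range[of n] by simp
      note s = high_step[OF high(1) this, folded xS]
      from z(2) s(3-5) high(2) show ?thesis
        by metis
    qed
    ultimately show ?case
      by metis
  qed
  have no_cycle: "upper_orbit_a a b i \<noteq> lower_orbit_a a b j" for i j
  proof -
    obtain n z where z: "upper_orbit_a a b i = Fin z"
      "z = x n \<or> x n < 1 \<and> (z = x n - 1 \<or> z = 1 / (1 - x n))"
      using upper by blast
    have up: "b < z \<or> a < z \<and> z < 0"
      using z(2)
    proof (elim disjE conjE)
      assume "x n < 1" "z = 1 / (1 - x n)"
      moreover from this have "1 \<le> 1 / (1 - x n)"
        using gt_b[of n] b_pos by simp
      ultimately show ?thesis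
        using b1 by linarith
    qed (use gt_b[of n] b in auto)
    obtain m y where y: "lower_orbit_a a b j = Fin y"
      "y = 1 - 1 / x m \<or> 1 < x m \<and> (y = - x m / (x m - 1) \<or> y = - 1 / (x m - 1))"
      using lower by blast
    from hole[of m] have lo: "y \<le> a \<or> 0 < y \<and> y \<le> b"
    proof (cases rule: not_hole_cases)
      case low
      have "b \<le> x m"
        using gt_b[of m] by simp
      then show ?thesis
        using low_step(5)[OF _ low(1)] y(2) low by auto
    next
      case high
      have top: "x m \<le> apex"
        using range[of m] by simp
      have "- 1 / (x m - 1) \<le> a"
        using top high a_neg by (simp add: field_simps)
      moreover have "- x m / (x m - 1) = - 1 / (x m - 1) - 1"
        using high by (simp add: field_simps)
      moreover have "0 < 1 - 1 / x m"
        using high by simp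
      moreover have "1 - 1 / x m \<le> b"
        using top high a_neg b by (simp add: field_simps)
      ultimately show ?thesis
        using y(2) by auto
    qed
    show ?thesis
      using up lo z(1) y(1) b_pos a_neg by auto
  qed
  have "Fin (x n) \<in> range (upper_orbit_a a b)" for n
  proof -
    have "apex \<in> {b..apex}"
      using b_le_apex by simp
    from track[OF this, of n] \<open>trapped\<close>
    obtain i where "(ab_map a b ^^ i) (Fin apex) = Fin (x n)"
      unfolding trapped_def x_def by blast
    then have "upper_orbit_a a b i = Fin (x n)"
      by (simp add: upper_orbit_a_apex)
    then show ?thesis
      by (metis rangeI)
  qed
  then have "range (\<lambda>n. Fin (x n)) \<subseteq> range (upper_orbit_a a b)"
    by blast
  moreover have "infinite (range (\<lambda>n. Fin (x n)))"
    using inj_x by (intro range_inj_infinite) (simp add: inj_def)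
  ultimately have "infinite (range (upper_orbit_a a b))"
    using finite_subset by blast
  then show ?thesis
    using no_cycle by (simp add: settled_def cycle_property_def)
qed

end

text \<open>
  The point at position \<open>\<rho>\<close> of the circle \<open>[0, 1)\<close> is to have the following itinerary: rotate
  repeatedly by \<open>\<alpha>\<close>, and read a low step of the Euclidean algorithm where the position is less
  than \<open>1 - \<alpha>\<close> and a high step elsewhere. Such a point is found by applying the inverse
  branches \<open>x / (1 + x)\<close> and \<open>1 + x\<close> in the order of this (Sturmian) itinerary; \<open>approx\<close> stops
  after \<open>k\<close> of them and inserts \<open>0\<close>.
\<close>

primrec approx :: "real \<Rightarrow> nat \<Rightarrow> real \<Rightarrow> real" where
  "approx \<alpha> 0 \<rho> = 0"
| "approx \<alpha> (Suc k) \<rho> =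
    (if \<rho> < 1 - \<alpha> then approx \<alpha> k (\<rho> + \<alpha>) / (1 + approx \<alpha> k (\<rho> + \<alpha>))
     else 1 + approx \<alpha> k (\<rho> + \<alpha> - 1))"

definition sturmian :: "real \<Rightarrow> real \<Rightarrow> real" where
  "sturmian \<alpha> \<rho> = lim (\<lambda>k. approx \<alpha> k \<rho>)"

text \<open>
  The value for the right end \<open>1\<close> of the circle, regarded as a high position; its successor is \<open>\<alpha>\<close>,
  like that of the low position \<open>0\<close>. The values at these two ends are to become \<open>- 1 / a\<close> and
  \<open>b = a + 1\<close>.
\<close>

definition sturmian_apex :: "real \<Rightarrow> real" where
  "sturmian_apex \<alpha> = 1 + sturmian \<alpha> \<alpha>"

lemma low_inverse_mono: "0 \<le> x \<Longrightarrow> x \<le> y \<Longrightarrow> x / (1 + x) \<le> y / (1 + y)" for x y :: real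
  by (simp add: field_simps)

lemma zero_if_multiples_bounded:
  fixes c :: real
  assumes "\<And>i::nat. \<bar>real i * c\<bar> \<le> 1"
  shows "c = 0"
proof (rule ccontr)
  assume "c \<noteq> 0"
  then obtain i :: nat where "1 < real i * \<bar>c\<bar>"
    using reals_Archimedean3[of "\<bar>c\<bar>"] by auto
  then show False
    using assms[of i] by (simp add: abs_mult)
qed

text \<open>
  For \<open>\<alpha> > 1 / 2\<close> the position \<open>\<alpha>\<close> is a high one, which gives \<open>sturmian_apex \<alpha> \<ge> 2\<close> at once, and
  an interval of such \<open>\<alpha>\<close> is enough for uncountability.
\<close>

locale rotation =
  fixes \<alpha> :: real
  assumes half_lt: "1 / 2 < \<alpha>" and lt_1: "\<alpha> < 1"
begin

lemma approx_nonneg: "0 \<le> approx \<alpha> k \<rho>"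
  by (induction k arbitrary: \<rho>) auto

text \<open>
  A low position has value below \<open>1\<close>, and each high step adds \<open>1\<close> while lowering the position by
  \<open>1 - \<alpha>\<close>; the bound is affine in \<open>\<rho>\<close> with just this slope.
\<close>

lemma approx_le: "0 \<le> \<rho> \<Longrightarrow> \<rho> < 1 \<Longrightarrow> approx \<alpha> k \<rho> \<le> 1 + \<rho> / (1 - \<alpha>)"
proof (induction k arbitrary: \<rho>)
  case 0
  then show ?case
    using lt_1 by simp
next
  case (Suc k)
  show ?case
  proof (cases "\<rho> < 1 - \<alpha>")
    case True
    have "approx \<alpha> (Suc k) \<rho> \<le> 1"
      using True approx_nonneg[of k "\<rho> + \<alpha>"] by simp
    moreover have "0 \<le> \<rho> / (1 - \<alpha>)"
      using Suc lt_1 by simp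
    ultimately show ?thesis
      by linarith
  next
    case False
    then have "approx \<alpha> (Suc k) \<rho> \<le> 1 + (1 + (\<rho> + \<alpha> - 1) / (1 - \<alpha>))"
      using Suc.IH[of "\<rho> + \<alpha> - 1"] Suc.prems lt_1 by simp
    also have "\<dots> = 1 + \<rho> / (1 - \<alpha>)"
      using lt_1 by (simp add: field_simps)
    finally show ?thesis .
  qed
qed

text \<open>
  The order of the circle positions is the lexicographic order of their itineraries: both inverse
  branches increase, and low values are at most \<open>1\<close> while high ones are at least \<open>1\<close>.
\<close>

lemma approx_mono: "0 \<le> \<rho> \<Longrightarrow> \<rho> \<le> \<sigma> \<Longrightarrow> approx \<alpha> k \<rho> \<le> approx \<alpha> k \<sigma>"
proof (induction k arbitrary: \<rho> \<sigma>)
  case (Suc k)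
  consider "\<sigma> < 1 - \<alpha>" | "\<rho> < 1 - \<alpha>" "1 - \<alpha> \<le> \<sigma>" | "1 - \<alpha> \<le> \<rho>"
    by linarith
  then show ?case
  proof cases
    case 1
    then show ?thesis
      using Suc.IH[of "\<rho> + \<alpha>" "\<sigma> + \<alpha>"] Suc.prems half_lt approx_nonneg
      by (simp add: low_inverse_mono)
  next
    case 2
    have "approx \<alpha> (Suc k) \<rho> \<le> 1"
      using 2 approx_nonneg[of k "\<rho> + \<alpha>"] by simp
    also have "1 \<le> approx \<alpha> (Suc k) \<sigma>"
      using 2 approx_nonneg by simp
    finally show ?thesis .
  next
    case 3
    then show ?thesis
      using Suc.IH[of "\<rho> + \<alpha> - 1" "\<sigma> + \<alpha> - 1"] Suc.prems by simp
  qed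
qed simp

lemma approx_Suc_ge: "approx \<alpha> k \<rho> \<le> approx \<alpha> (Suc k) \<rho>"
proof (induction k arbitrary: \<rho>)
  case 0
  show ?case
    using approx_nonneg by simp
next
  case (Suc k)
  show ?case
    using Suc.IH[of "\<rho> + \<alpha>"] Suc.IH[of "\<rho> + \<alpha> - 1"] approx_nonneg
    by (simp only: approx.simps(2)[of \<alpha> "Suc k"] approx.simps(2)[of \<alpha> k \<rho>])
       (simp add: low_inverse_mono del: approx.simps)
qed

lemma sturmian_tendsto:
  assumes "0 \<le> \<rho>" "\<rho> < 1"
  shows "(\<lambda>k. approx \<alpha> k \<rho>) \<longlonglongrightarrow> sturmian \<alpha> \<rho>"
proof -
  have "incseq (\<lambda>k. approx \<alpha> k \<rho>)"
    using approx_Suc_ge by (intro incseq_SucI)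
  then obtain L where "(\<lambda>k. approx \<alpha> k \<rho>) \<longlonglongrightarrow> L"
    using incseq_convergent approx_le[OF assms] by blast
  then show ?thesis
    unfolding sturmian_def by (simp add: limI)
qed

lemma sturmian_nonneg: "0 \<le> \<rho> \<Longrightarrow> \<rho> < 1 \<Longrightarrow> 0 \<le> sturmian \<alpha> \<rho>"
  using sturmian_tendsto approx_nonneg by (meson LIMSEQ_le_const)

lemma sturmian_mono: "0 \<le> \<rho> \<Longrightarrow> \<rho> \<le> \<sigma> \<Longrightarrow> \<sigma> < 1 \<Longrightarrow> sturmian \<alpha> \<rho> \<le> sturmian \<alpha> \<sigma>"
  using LIMSEQ_le[OF sturmian_tendsto sturmian_tendsto] approx_mono by auto

lemma sturmian_low:
  assumes "0 \<le> \<rho>" "\<rho> < 1 - \<alpha>"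
  shows "sturmian \<alpha> \<rho> = sturmian \<alpha> (\<rho> + \<alpha>) / (1 + sturmian \<alpha> (\<rho> + \<alpha>))"
proof (rule LIMSEQ_unique)
  show "(\<lambda>k. approx \<alpha> (Suc k) \<rho>) \<longlonglongrightarrow> sturmian \<alpha> \<rho>"
    using sturmian_tendsto assms half_lt by (intro LIMSEQ_Suc) simp
  have "0 \<le> sturmian \<alpha> (\<rho> + \<alpha>)"
    using assms half_lt by (intro sturmian_nonneg) auto
  then have "(\<lambda>k. approx \<alpha> k (\<rho> + \<alpha>) / (1 + approx \<alpha> k (\<rho> + \<alpha>)))
      \<longlonglongrightarrow> sturmian \<alpha> (\<rho> + \<alpha>) / (1 + sturmian \<alpha> (\<rho> + \<alpha>))"
    using assms half_lt by (intro tendsto_intros sturmian_tendsto) auto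
  then show "(\<lambda>k. approx \<alpha> (Suc k) \<rho>) \<longlonglongrightarrow> sturmian \<alpha> (\<rho> + \<alpha>) / (1 + sturmian \<alpha> (\<rho> + \<alpha>))"
    using assms by simp
qed

lemma sturmian_high:
  assumes "1 - \<alpha> \<le> \<rho>" "\<rho> < 1"
  shows "sturmian \<alpha> \<rho> = 1 + sturmian \<alpha> (\<rho> + \<alpha> - 1)"
proof (rule LIMSEQ_unique)
  show "(\<lambda>k. approx \<alpha> (Suc k) \<rho>) \<longlonglongrightarrow> sturmian \<alpha> \<rho>"
    using sturmian_tendsto assms lt_1 by (intro LIMSEQ_Suc) simp
  have "(\<lambda>k. 1 + approx \<alpha> k (\<rho> + \<alpha> - 1)) \<longlonglongrightarrow> 1 + sturmian \<alpha> (\<rho> + \<alpha> - 1)"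
    using assms lt_1 by (intro tendsto_intros sturmian_tendsto) auto
  then show "(\<lambda>k. approx \<alpha> (Suc k) \<rho>) \<longlonglongrightarrow> 1 + sturmian \<alpha> (\<rho> + \<alpha> - 1)"
    using assms by simp
qed

lemma sturmian_ge_1_iff:
  assumes "0 \<le> \<rho>" "\<rho> < 1"
  shows "1 \<le> sturmian \<alpha> \<rho> \<longleftrightarrow> 1 - \<alpha> \<le> \<rho>"
proof (cases "\<rho> < 1 - \<alpha>")
  case True
  then have "0 \<le> sturmian \<alpha> (\<rho> + \<alpha>)"
    using assms half_lt by (intro sturmian_nonneg) auto
  then have "sturmian \<alpha> \<rho> < 1"
    using sturmian_low[OF assms(1) True] by simp
  then show ?thesis
    using True by simp
next
  case False
  then have "0 \<le> sturmian \<alpha> (\<rho> + \<alpha> - 1)"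
    using assms lt_1 by (intro sturmian_nonneg) auto
  then show ?thesis
    using sturmian_high[of \<rho>] False assms by simp
qed

lemma frac_floor_alpha: "frac \<alpha> = \<alpha>" "\<lfloor>\<alpha>\<rfloor> = 0"
  using half_lt lt_1 by (auto simp: frac_eq floor_eq_iff)

lemma euclid_step_sturmian:
  assumes "0 \<le> \<rho>" "\<rho> < 1"
  shows "euclid_step (sturmian \<alpha> \<rho>) =
    sturmian \<alpha> (if \<rho> + \<alpha> < 1 then \<rho> + \<alpha> else \<rho> + \<alpha> - 1)"
proof (cases "\<rho> < 1 - \<alpha>")
  case True
  then have c: "0 \<le> sturmian \<alpha> (\<rho> + \<alpha>)"
    using assms half_lt by (intro sturmian_nonneg) auto
  have "sturmian \<alpha> \<rho> < 1"
    using sturmian_ge_1_iff[OF assms] True by linarith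
  moreover have "1 - sturmian \<alpha> \<rho> = 1 / (1 + sturmian \<alpha> (\<rho> + \<alpha>))"
    using sturmian_low[OF assms(1) True] c by (simp add: field_simps)
  ultimately show ?thesis
    using sturmian_low[OF assms(1) True] c True by (simp add: euclid_step_def)
next
  case False
  then have "1 \<le> sturmian \<alpha> \<rho>"
    using sturmian_ge_1_iff[OF assms] by linarith
  then show ?thesis
    using sturmian_high[of \<rho>] False assms by (simp add: euclid_step_def)
qed

lemma orbit_sturmian: "(euclid_step ^^ Suc n) (sturmian_apex \<alpha>) = sturmian \<alpha> (frac (real (Suc n) * \<alpha>))"
proof (induction n)
  case 0
  have "0 \<le> sturmian \<alpha> \<alpha>"
    using half_lt lt_1 by (intro sturmian_nonneg) auto
  then show ?case
    by (simp add: frac_floor_alpha sturmian_apex_def euclid_step_def)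
next
  case (Suc n)
  have "real (Suc (Suc n)) * \<alpha> = real (Suc n) * \<alpha> + \<alpha>"
    by (simp add: algebra_simps)
  then have "frac (real (Suc (Suc n)) * \<alpha>) = (let r = frac (real (Suc n) * \<alpha>) in
      if r + \<alpha> < 1 then r + \<alpha> else r + \<alpha> - 1)"
    by (simp only: frac_add frac_floor_alpha Let_def)
  then show ?case
    using Suc euclid_step_sturmian[of "frac (real (Suc n) * \<alpha>)"]
    by (simp add: Let_def frac_lt_1 del: of_nat_Suc)
qed

text \<open>
  The itinerary of the orbit determines the integer parts of the multiples of \<open>\<alpha>\<close>, and so \<open>\<alpha>\<close>.
\<close>

lemma floor_step:
  "\<lfloor>real (Suc (Suc n)) * \<alpha>\<rfloor> =
    \<lfloor>real (Suc n) * \<alpha>\<rfloor> + of_bool (1 \<le> (euclid_step ^^ Suc n) (sturmian_apex \<alpha>))"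
proof -
  have "real (Suc (Suc n)) * \<alpha> = real (Suc n) * \<alpha> + \<alpha>"
    by (simp add: algebra_simps)
  then have "\<lfloor>real (Suc (Suc n)) * \<alpha>\<rfloor> = \<lfloor>real (Suc n) * \<alpha>\<rfloor> +
      of_bool (1 - \<alpha> \<le> frac (real (Suc n) * \<alpha>))"
    by (simp only: floor_add frac_floor_alpha) auto
  then show ?thesis
    unfolding orbit_sturmian using sturmian_ge_1_iff[of "frac (real (Suc n) * \<alpha>)"]
    by (simp add: frac_lt_1 del: of_nat_Suc)
qed

text \<open>
  If the orbit repeated with period \<open>d\<close>, the integer parts of \<open>n \<alpha>\<close> would grow linearly along
  multiples of \<open>d\<close>, with a rational slope that would have to be \<open>\<alpha>\<close>.
\<close>

lemma inj_orbit:
  assumes "\<alpha> \<notin> \<rat>"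
  shows "inj (\<lambda>n. (euclid_step ^^ n) (sturmian_apex \<alpha>))"
proof (rule ccontr)
  define x where "x n = (euclid_step ^^ n) (sturmian_apex \<alpha>)" for n
  define F where "F n = \<lfloor>real (Suc n) * \<alpha>\<rfloor>" for n
  assume "\<not> ?thesis"
  then obtain p q where pq: "p < q" "x p = x q"
    unfolding inj_def x_def by (metis linorder_neqE_nat)
  define d where "d = q - p"
  have per: "x (p + d + j) = x (p + j)" for j
    using pq by (induction j) (auto simp: d_def x_def)
  have "F (p + d + j) - F (p + j) = F (p + d) - F p" for j
  proof (induction j)
    case (Suc j)
    have "x (Suc (p + d + j)) = x (Suc (p + j))"
      using per[of "Suc j"] by simp
    then show ?case
      using Suc floor_step[of "p + d + j"] floor_step[of "p + j"] by (simp add: F_def x_def)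
  qed simp
  then have shift: "F (p + d + j) = F (p + j) + (F (p + d) - F p)" for j
    by (metis add.commute diff_add_cancel)
  have lin: "F (p + i * d) = F p + int i * (F (p + d) - F p)" for i
  proof (induction i)
    case (Suc i)
    then show ?case
      using shift[of "i * d"] by (simp add: algebra_simps)
  qed simp
  have "\<bar>real i * (real d * \<alpha> - of_int (F (p + d) - F p))\<bar> \<le> 1" for i
  proof -
    have "real_of_int (F (p + i * d)) = of_int (F p) + real i * of_int (F (p + d) - F p)"
      using lin[of i] by simp
    moreover have "real (Suc (p + i * d)) * \<alpha> = real (Suc p) * \<alpha> + real i * (real d * \<alpha>)"
      by (simp add: algebra_simps)
    moreover have "of_int (F n) \<le> real (Suc n) * \<alpha>" "real (Suc n) * \<alpha> < of_int (F n) + 1" for n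
      unfolding F_def by linarith+
    note this[of p] this[of "p + i * d"]
    ultimately show ?thesis
      unfolding right_diff_distrib by linarith
  qed
  then have "real d * \<alpha> - of_int (F (p + d) - F p) = 0"
    by (rule zero_if_multiples_bounded)
  then have "\<alpha> = of_int (F (p + d) - F p) / of_nat d"
    using pq by (simp add: d_def field_simps)
  then have "\<alpha> \<in> \<rat>"
    by (metis Rats_divide Rats_of_int Rats_of_nat)
  then show False
    using assms by simp
qed

lemma sturmian_apex_ge_2: "2 \<le> sturmian_apex \<alpha>"
  using sturmian_ge_1_iff[of \<alpha>] half_lt lt_1 by (simp add: sturmian_apex_def)

text \<open>
  By monotonicity the values of \<open>sturmian \<alpha>\<close> lie between its value \<open>b\<close> at \<open>0\<close> and
  \<open>sturmian_apex \<alpha> = - 1 / a\<close>. The functional equations turn these bounds, one step further, into the two ends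
  of the hole, so the orbit of \<open>- 1 / a\<close> never enters it.
\<close>

lemma sturmian_exception:
  assumes "\<alpha> \<notin> \<rat>"
  shows "(- 1 / sturmian_apex \<alpha>, - 1 / sturmian_apex \<alpha> + 1) \<in> exceptions"
proof -
  define a where "a = - 1 / sturmian_apex \<alpha>"
  have a: "- 1 < a" "a < 0"
    using sturmian_apex_ge_2 by (auto simp: a_def)
  then interpret interior_params a "a + 1"
    by (rule interior_params_boundary)
  have apex: "apex = sturmian_apex \<alpha>"
    using sturmian_apex_ge_2 by (simp add: a_def)
  have nonneg: "0 \<le> sturmian \<alpha> \<alpha>"
    using sturmian_apex_ge_2 by (simp add: sturmian_apex_def)
  have b: "a + 1 = sturmian \<alpha> 0"
    using sturmian_low[of 0] lt_1 nonneg by (simp add: a_def sturmian_apex_def field_simps)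
  have le_apex: "sturmian \<alpha> \<rho> \<le> apex" if "0 \<le> \<rho>" "\<rho> < 1" for \<rho>
  proof (cases "\<rho> < 1 - \<alpha>")
    case True
    then show ?thesis
      using sturmian_ge_1_iff[OF that] apex_gt_1 by linarith
  next
    case False
    then have "sturmian \<alpha> (\<rho> + \<alpha> - 1) \<le> sturmian \<alpha> \<alpha>"
      using that lt_1 by (intro sturmian_mono) auto
    then show ?thesis
      using sturmian_high[of \<rho>] False that unfolding apex sturmian_apex_def by simp
  qed
  have sturmian_hole: "sturmian \<alpha> \<rho> \<notin> hole" if "0 \<le> \<rho>" "\<rho> < 1" for \<rho>
  proof (cases "\<rho> < 1 - \<alpha>")
    case True
    have "sturmian \<alpha> \<rho> = sturmian \<alpha> (\<rho> + \<alpha>) / (1 + sturmian \<alpha> (\<rho> + \<alpha>))"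
      by (rule sturmian_low[OF that(1) True])
    also have "\<dots> \<le> apex / (1 + apex)"
      using True that half_lt by (intro low_inverse_mono le_apex sturmian_nonneg) auto
    also have "\<dots> = 1 / (1 - a)"
      using a_neg by (simp add: field_simps)
    finally show ?thesis
      by (simp add: hole_def)
  next
    case False
    then have "sturmian \<alpha> 0 \<le> sturmian \<alpha> (\<rho> + \<alpha> - 1)"
      using that lt_1 by (intro sturmian_mono) auto
    then show ?thesis
      unfolding hole_def using sturmian_high[of \<rho>] False that b by simp
  qed
  have "(euclid_step ^^ n) apex \<notin> hole" for n
  proof (cases n)
    case 0
    have "sturmian \<alpha> 0 \<le> sturmian \<alpha> \<alpha>"
      using half_lt lt_1 by (intro sturmian_mono) auto
    then show ?thesis
      using 0 b unfolding apex sturmian_apex_def hole_def by simp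
  next
    case (Suc m)
    then show ?thesis
      using orbit_sturmian[of m] sturmian_hole[of "frac (real n * \<alpha>)"]
      unfolding apex by (simp add: frac_lt_1)
  qed
  then have "\<not> settled a (a + 1)"
    using not_settled_if_inj inj_orbit[OF assms] unfolding trapped_def apex by blast
  then have "(a, a + 1) \<in> exceptions"
    using a hyperbola finiteness_condition_iff_settled[of a "a + 1"]
    by (auto simp: exceptions_def param_set_def nondegenerate_def)
  then show ?thesis
    by (simp add: a_def)
qed

end

lemma inj_sturmian_apex: "inj_on sturmian_apex {1 / 2<..<1}"
proof (rule inj_onI)
  fix \<alpha> \<beta> :: real
  assume "\<alpha> \<in> {1 / 2<..<1}" "\<beta> \<in> {1 / 2<..<1}" and eq: "sturmian_apex \<alpha> = sturmian_apex \<beta>"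
  then interpret A: rotation \<alpha> + B: rotation \<beta>
    by unfold_locales auto
  have floor_eq: "\<lfloor>real (Suc n) * \<alpha>\<rfloor> = \<lfloor>real (Suc n) * \<beta>\<rfloor>" for n
  proof (induction n)
    case 0
    then show ?case
      by (simp add: A.frac_floor_alpha B.frac_floor_alpha)
  next
    case (Suc n)
    then show ?case
      using A.floor_step[of n] B.floor_step[of n] eq by simp
  qed
  have "\<bar>real i * (\<alpha> - \<beta>)\<bar> \<le> 1" for i
  proof (cases i)
    case (Suc n)
    then have "\<lfloor>real i * \<alpha>\<rfloor> = \<lfloor>real i * \<beta>\<rfloor>"
      using floor_eq by simp
    then show ?thesis
      unfolding right_diff_distrib by linarith
  qed simp
  then have "\<alpha> - \<beta> = 0"
    by (rule zero_if_multiples_bounded)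
  then show "\<alpha> = \<beta>"
    by simp
qed

lemma uncountable_exceptions: "uncountable exceptions"
proof -
  define S where "S = {1 / 2<..<1} - (\<rat> :: real set)"
  define g where "g \<alpha> = (- 1 / sturmian_apex \<alpha>, - 1 / sturmian_apex \<alpha> + 1)" for \<alpha>
  have "uncountable S"
    unfolding S_def by (intro uncountable_minus_countable countable_rat)
      (simp add: uncountable_open_interval)
  moreover have "inj_on g S"
  proof (rule inj_onI)
    fix \<alpha> \<beta> assume S: "\<alpha> \<in> S" "\<beta> \<in> S" and "g \<alpha> = g \<beta>"
    then have "sturmian_apex \<alpha> = sturmian_apex \<beta>"
      by (simp add: g_def)
    then show "\<alpha> = \<beta>"
      using inj_sturmian_apex S by (auto simp: S_def inj_on_def)
  qed
  moreover have "g ` S \<subseteq> exceptions"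
    using rotation.sturmian_exception by (auto simp: g_def S_def rotation_def)
  ultimately show ?thesis
    using countable_subset countable_image_inj_on by blast
qed

section \<open>The exceptional set\<close>

theorem theorem8p11:
  shows "(\<forall>a b. (a, b) \<in> param_set \<and> nondegenerate a b \<and> b \<noteq> a + 1 \<longrightarrow> finiteness_condition a b) \<and>
    uncountable exceptions \<and>
    exceptions \<subseteq> {(a, b). b = a + 1} \<inter> frontier param_set \<and>
    null_on_boundary_line exceptions"
proof (intro conjI)
  show "exceptions \<subseteq> {(a, b). b = a + 1} \<inter> frontier param_set"
  proof (rule subrelI)
    fix a b assume e: "(a, b) \<in> exceptions"
    then have "b = a + 1" "(a, b) \<in> param_set"
      using exception_imp_boundary by (auto simp: exceptions_def)
    then show "(a, b) \<in> {(a, b). b = a + 1} \<inter> frontier param_set"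
      using boundary_in_frontier by auto
  qed
qed (use finiteness_off_boundary uncountable_exceptions null_exceptions in auto)

end
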